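(* Let $\gamma>0$, let $\Omega\subset\mathbb{R}^N$ be a bounded smooth domain, and let $f:[0,\infty)\to\mathbb{R}$ be locally Lipschitz continuous and non-decreasing, with $f(s)>0$ for $s>0$ and $f(0)\ge 0$. Let $u\in C(\overline{\Omega})\cap C^2(\Omega)$ be a solution to $$-\Delta u=\frac{1}{u^\gamma}+f(u)\ \text{ in }\Omega,\qquad u>0\ \text{ in }\Omega,\qquad u=0\ \text{ on }\partial\Omega .$$ Let $\nu\in S^{N-1}$ and assume that $\Omega$ is strictly convex with respect to the $\nu$-direction and symmetric with respect to the hyperplane $T_0^\nu=\{x\in\mathbb{R}^N: x\cdot\nu=0\}$. Then $u$ is symmetric with respect to $T_0^\nu$ and non-decreasing with respect to the $\nu$-direction in $\Omega_0^\nu=\{x\in\Omega: x\cdot\nu<0\}$. Moreover, if $\Omega$ is a ball, then $u$ is radially symmetric (about the center of the ball) with $\frac{\partial u}{\partial r}(r)<0$ for $r\neq 0$.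
   Context: $\Omega$ is strictly convex with respect to the $\nu$-direction if for any two distinct points $p,q\in\overline\Omega$ with $q-p$ parallel to $\nu$, the open segment joining $p$ and $q$ is contained in $\Omega$. Symmetry of $\Omega$ with respect to $T_0^\nu$ means invariance under the reflection $x\mapsto x-2(x\cdot\nu)\nu$; symmetry of $u$ means $u(x)=u(x-2(x\cdot\nu)\nu)$ for $x\in\Omega$. In the ball case, $r$ denotes the distance from the center of the ball. The equation is satisfied in the classical sense in $\Omega$. *)

theory Defs
  imports "HOL-Analysis.Analysis"
begin

text \<open>The class \<open>C\<^sup>k(S)\<close>; meant for open \<open>S\<close>. In finite dimension, continuity of all
  directional derivatives \<open>y \<mapsto> Df(y) v\<close> is continuity of \<open>Df\<close>.\<close>

primrec Ck_on :: "nat \<Rightarrow> 'a::euclidean_space set \<Rightarrow> ('a \<Rightarrow> real) \<Rightarrow> bool" where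
  "Ck_on 0 S f \<longleftrightarrow> continuous_on S f"
| "Ck_on (Suc k) S f \<longleftrightarrow>
     (\<forall>x\<in>S. f differentiable (at x)) \<and>
     (\<forall>v. Ck_on k S (\<lambda>x. frechet_derivative f (at x) v))"

definition smooth_on :: "'a::euclidean_space set \<Rightarrow> ('a \<Rightarrow> real) \<Rightarrow> bool" where
  "smooth_on S f \<longleftrightarrow> (\<forall>k. Ck_on k S f)"

definition laplacian :: "('a::euclidean_space \<Rightarrow> real) \<Rightarrow> 'a \<Rightarrow> real" where
  "laplacian u x =
     (\<Sum>b\<in>Basis. frechet_derivative (\<lambda>y. frechet_derivative u (at y) b) (at x) b)"

text \<open>The boundary is locally a smooth graph in some direction \<open>e\<close>, with the domain lying
  strictly on one side of it. The graph function lives on the hyperplane orthogonal to \<open>e\<close>;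
  it is encoded as a smooth function \<open>g\<close> on the whole space that is evaluated only at the
  projection \<open>x - (x \<bullet> e) e\<close>.\<close>

definition smooth_boundary :: "'a::euclidean_space set \<Rightarrow> bool" where
  "smooth_boundary \<Omega> \<longleftrightarrow>
     (\<forall>z \<in> frontier \<Omega>. \<exists>r e g. r > 0 \<and> norm e = 1 \<and> smooth_on UNIV g \<and>
        \<Omega> \<inter> ball z r = {x \<in> ball z r. g (x - (x \<bullet> e) *\<^sub>R e) < x \<bullet> e})"

definition bounded_smooth_domain :: "'a::euclidean_space set \<Rightarrow> bool" where
  "bounded_smooth_domain \<Omega> \<longleftrightarrow>
     open \<Omega> \<and> connected \<Omega> \<and> \<Omega> \<noteq> {} \<and> bounded \<Omega> \<and> smooth_boundary \<Omega>"

definition locally_lipschitz_on :: "real set \<Rightarrow> (real \<Rightarrow> real) \<Rightarrow> bool" where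
  "locally_lipschitz_on S f \<longleftrightarrow> (\<forall>s\<in>S. \<exists>\<delta>>0. \<exists>L. L-lipschitz_on (ball s \<delta> \<inter> S) f)"

definition singular_solution ::
  "real \<Rightarrow> (real \<Rightarrow> real) \<Rightarrow> 'a::euclidean_space set \<Rightarrow> ('a \<Rightarrow> real) \<Rightarrow> bool" where
  "singular_solution \<gamma> f \<Omega> u \<longleftrightarrow>
     continuous_on (closure \<Omega>) u \<and> Ck_on 2 \<Omega> u \<and>
     (\<forall>x\<in>\<Omega>. - laplacian u x = 1 / (u x powr \<gamma>) + f (u x)) \<and>
     (\<forall>x\<in>\<Omega>. u x > 0) \<and>
     (\<forall>x\<in>frontier \<Omega>. u x = 0)"

definition reflect :: "'a::euclidean_space \<Rightarrow> 'a \<Rightarrow> 'a" where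
  "reflect \<nu> x = x - (2 * (x \<bullet> \<nu>)) *\<^sub>R \<nu>"

definition strictly_convex_dir :: "'a::euclidean_space \<Rightarrow> 'a set \<Rightarrow> bool" where
  "strictly_convex_dir \<nu> \<Omega> \<longleftrightarrow>
     (\<forall>p \<in> closure \<Omega>. \<forall>q \<in> closure \<Omega>.
        p \<noteq> q \<and> (\<exists>t. q - p = t *\<^sub>R \<nu>) \<longrightarrow> open_segment p q \<subseteq> \<Omega>)"

definition nondecreasing_dir :: "'a::euclidean_space \<Rightarrow> 'a set \<Rightarrow> ('a \<Rightarrow> real) \<Rightarrow> bool" where
  "nondecreasing_dir \<nu> S u \<longleftrightarrow>
     (\<forall>x\<in>S. \<forall>t\<ge>0. x + t *\<^sub>R \<nu> \<in> S \<longrightarrow> u x \<le> u (x + t *\<^sub>R \<nu>))"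

end

theory Submission
  imports Defs
begin

text \<open>
  The proof is by moving planes. For \<open>\<tau> < 0\<close> let \<open>R\<^sub>\<tau>\<close> be the reflection in the hyperplane
  \<open>x \<bullet> \<nu> = \<tau>\<close> and let \<open>w\<^sub>\<tau> = u \<circ> R\<^sub>\<tau> - u\<close> on the part of the closed domain where
  \<open>x \<bullet> \<nu> \<le> \<tau>\<close>; strict convexity and symmetry put \<open>R\<^sub>\<tau> x\<close> in \<open>\<Omega>\<close> as soon as \<open>x \<bullet> \<nu> < \<tau>\<close>.
  The goal is \<open>w\<^sub>\<tau> \<ge> 0\<close> for every \<open>\<tau> < 0\<close>. The singular term never hurts, for two reasons.

  \<^item> At a point where \<open>w\<^sub>\<tau> < 0\<close>, the decreasing function \<open>s powr (-\<gamma>)\<close> contributes with the good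
    sign, so that \<open>\<Delta> w\<^sub>\<tau> \<le> - L w\<^sub>\<tau>\<close> with \<open>L\<close> a Lipschitz constant of \<open>f\<close> alone. Hence \<open>w\<^sub>\<tau>\<close> obeys the
    maximum principle in slabs \<open>\<mu> \<le> x \<bullet> \<nu> \<le> \<tau>\<close> of width at most a fixed \<open>\<delta>\<close>, without any control of
    \<open>u\<close> near the boundary (\<open>gap_nonneg_extend\<close>).

  \<^item> Where \<open>w\<^sub>\<tau> \<ge> 0\<close>, monotonicity of \<open>f\<close> gives \<open>\<Delta> w\<^sub>\<tau> \<le> C w\<^sub>\<tau>\<close> on compact subsets of \<open>\<Omega>\<close>, so that
    the strong maximum principle applies. At boundary points of \<open>\<Omega>\<close> with \<open>x \<bullet> \<nu> < \<tau>\<close>,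
    \<open>w\<^sub>\<tau> = u \<circ> R\<^sub>\<tau> > 0\<close>; therefore \<open>w\<^sub>\<tau> > 0\<close> wherever \<open>x \<bullet> \<nu> < \<tau>\<close> (\<open>gap_strictly_pos\<close>).

  If the set of bad \<open>\<tau>\<close> were nonempty, with infimum \<open>\<tau>\<^sub>0 < 0\<close>, then \<open>w\<^sub>\<tau> > 0\<close> at
  \<open>\<tau> = \<tau>\<^sub>0\<close> would persist, by compactness, for \<open>\<tau>\<close> near \<open>\<tau>\<^sub>0\<close> on the set \<open>x \<bullet> \<nu> \<le> \<tau>\<^sub>0 - \<delta> / 2\<close>.
  What remains lies in a narrow slab, where the first point applies; so there is no bad \<open>\<tau>\<close> (\<open>gap_nonneg\<close>). This gives monotonicity, and symmetry on
  letting \<open>\<tau> \<rightarrow> 0\<close> for both \<open>\<nu>\<close> and \<open>- \<nu>\<close>.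

  In a ball the argument works for every direction, with the hyperplanes stopping at the centre;
  two points at equal distance from the centre are exchanged by a reflection through it, so \<open>u\<close> is
  radial with a non-increasing profile \<open>U\<close>. If \<open>U' r = 0\<close> for some \<open>r > 0\<close>, then \<open>U'\<close> is maximal
  at \<open>r\<close>, so \<open>U'' r = 0\<close>, and the tangential second derivatives equal \<open>U' r / r = 0\<close>. Then
  \<open>\<Delta> u = 0\<close>, which contradicts \<open>- \<Delta> u > 0\<close> (\<open>radial_profile_derivative_neg\<close>).
\<close>

section \<open>Second derivatives and Laplacians along lines\<close>

text \<open>Second derivative at \<open>0\<close>: \<open>h\<close> is differentiable near \<open>0\<close> and its derivative is differentiable
  at \<open>0\<close> with value \<open>d\<close>.\<close>

definition has_deriv2 :: "(real \<Rightarrow> real) \<Rightarrow> real \<Rightarrow> bool" where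
  "has_deriv2 h d \<longleftrightarrow>
     (\<exists>h'. (\<forall>\<^sub>F t in nhds 0. (h has_real_derivative h' t) (at t)) \<and>
           (h' has_real_derivative d) (at 0))"

lemma has_deriv2I:
  assumes "\<And>t. (h has_real_derivative h' t) (at t)" "(h' has_real_derivative d) (at 0)"
  shows "has_deriv2 h d"
  using assms unfolding has_deriv2_def by (intro exI[of _ h'] conjI always_eventually allI)

lemma has_deriv2_add:
  assumes "has_deriv2 h d" "has_deriv2 k e"
  shows "has_deriv2 (\<lambda>t. h t + k t) (d + e)"
proof -
  obtain h' k' where
    h: "\<forall>\<^sub>F t in nhds 0. (h has_real_derivative h' t) (at t)" "(h' has_real_derivative d) (at 0)" and
    k: "\<forall>\<^sub>F t in nhds 0. (k has_real_derivative k' t) (at t)" "(k' has_real_derivative e) (at 0)"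
    using assms unfolding has_deriv2_def by blast
  have "\<forall>\<^sub>F t in nhds 0. ((\<lambda>t. h t + k t) has_real_derivative h' t + k' t) (at t)"
    using h(1) k(1) by eventually_elim (rule DERIV_add)
  moreover have "((\<lambda>t. h' t + k' t) has_real_derivative d + e) (at 0)"
    using h(2) k(2) by (rule DERIV_add)
  ultimately show ?thesis unfolding has_deriv2_def by (intro exI conjI)
qed

lemma has_deriv2_cmult:
  assumes "has_deriv2 h d"
  shows "has_deriv2 (\<lambda>t. c * h t) (c * d)"
proof -
  obtain h' where
    h: "\<forall>\<^sub>F t in nhds 0. (h has_real_derivative h' t) (at t)" "(h' has_real_derivative d) (at 0)"
    using assms unfolding has_deriv2_def by blast
  have "\<forall>\<^sub>F t in nhds 0. ((\<lambda>t. c * h t) has_real_derivative c * h' t) (at t)"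
    using h(1) by eventually_elim (rule DERIV_cmult)
  moreover have "((\<lambda>t. c * h' t) has_real_derivative c * d) (at 0)"
    using h(2) by (rule DERIV_cmult)
  ultimately show ?thesis unfolding has_deriv2_def by (intro exI conjI)
qed

lemma has_deriv2_cong:
  assumes "has_deriv2 h d" "\<forall>\<^sub>F t in nhds 0. h t = k t"
  shows "has_deriv2 k d"
proof -
  obtain h' where
    h: "\<forall>\<^sub>F t in nhds 0. (h has_real_derivative h' t) (at t)" "(h' has_real_derivative d) (at 0)"
    using assms(1) unfolding has_deriv2_def by blast
  have "\<forall>\<^sub>F t in nhds 0. \<forall>\<^sub>F s in nhds t. h s = k s"
    using assms(2) by (simp add: eventually_eventually)
  then have "\<forall>\<^sub>F t in nhds 0. (k has_real_derivative h' t) (at t)"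
    using h(1) by eventually_elim (use DERIV_cong_ev in blast)
  with h(2) show ?thesis unfolding has_deriv2_def by blast
qed

lemma has_deriv2_unique:
  assumes "has_deriv2 h d" "has_deriv2 h e"
  shows "d = e"
proof -
  obtain h' k' where
    h: "\<forall>\<^sub>F t in nhds 0. (h has_real_derivative h' t) (at t)" "(h' has_real_derivative d) (at 0)" and
    k: "\<forall>\<^sub>F t in nhds 0. (h has_real_derivative k' t) (at t)" "(k' has_real_derivative e) (at 0)"
    using assms unfolding has_deriv2_def by blast
  have "\<forall>\<^sub>F t in nhds 0. h' t = k' t"
    using h(1) k(1) by eventually_elim (rule DERIV_unique)
  then have "(k' has_real_derivative d) (at 0)"
    using h(2) DERIV_cong_ev by blast
  with k(2) show ?thesis using DERIV_unique by blast
qed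

lemma has_deriv2_local_min:
  assumes "has_deriv2 h d" "\<forall>\<^sub>F t in nhds 0. h 0 \<le> h t"
  shows "d \<ge> 0"
proof (rule ccontr)
  assume "\<not> d \<ge> 0"
  obtain h' where
    h: "\<forall>\<^sub>F t in nhds 0. (h has_real_derivative h' t) (at t)" "(h' has_real_derivative d) (at 0)"
    using assms(1) unfolding has_deriv2_def by blast
  have "\<forall>\<^sub>F t in nhds 0. (h has_real_derivative h' t) (at t) \<and> h 0 \<le> h t"
    using h(1) assms(2) by (rule eventually_conj)
  then obtain r where r: "r > 0"
    "\<And>t. \<bar>t\<bar> < r \<Longrightarrow> (h has_real_derivative h' t) (at t) \<and> h 0 \<le> h t"
    unfolding eventually_nhds_metric by (auto simp: dist_real_def)
  have "h' 0 = 0"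
    by (rule DERIV_local_min[of h "h' 0" 0 r]) (use r in auto)
  obtain s where s: "s > 0" "\<And>t. 0 < t \<Longrightarrow> t < s \<Longrightarrow> h' (0 + t) < h' 0"
    using DERIV_neg_dec_right[OF h(2)] \<open>\<not> d \<ge> 0\<close> by auto
  define t where "t = min r s / 2"
  have t: "0 < t" "t < r" "t < s" using r(1) s(1) by (auto simp: t_def min_def)
  have "\<And>x. 0 \<le> x \<Longrightarrow> x \<le> t \<Longrightarrow> (h has_real_derivative h' x) (at x)"
    using r(2) t by auto
  then obtain z where z: "0 < z" "z < t" "h t - h 0 = (t - 0) * h' z"
    using MVT2[of 0 t h h'] t by blast
  have "h' z < 0" using s(2)[of z] z t \<open>h' 0 = 0\<close> by auto
  then have "h t < h 0" using z(3) t mult_pos_neg[of t "h' z"] by auto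
  then show False using r(2)[of t] t by auto
qed

text \<open>The Laplacian as the sum of the pure second derivatives along the coordinate lines. As a relation
  it does not ask for a second Frechet derivative, so that it can be computed for barriers and
  reflected functions one line at a time.\<close>

definition has_laplacian :: "('a::euclidean_space \<Rightarrow> real) \<Rightarrow> real \<Rightarrow> 'a \<Rightarrow> bool" where
  "has_laplacian v l x \<longleftrightarrow>
     (\<exists>d. (\<forall>b\<in>Basis. has_deriv2 (\<lambda>t. v (x + t *\<^sub>R b)) (d b)) \<and> l = (\<Sum>b\<in>Basis. d b))"

lemma has_laplacianI:
  assumes "\<And>b. b \<in> Basis \<Longrightarrow> has_deriv2 (\<lambda>t. v (x + t *\<^sub>R b)) (d b)" "(\<Sum>b\<in>Basis. d b) = l"
  shows "has_laplacian v l x"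
  using assms unfolding has_laplacian_def by blast

lemma has_laplacian_add:
  assumes "has_laplacian v l x" "has_laplacian w k x"
  shows "has_laplacian (\<lambda>y. v y + w y) (l + k) x"
proof -
  obtain d e where
    "\<forall>b\<in>Basis. has_deriv2 (\<lambda>t. v (x + t *\<^sub>R b)) (d b)" "l = (\<Sum>b\<in>Basis. d b)"
    "\<forall>b\<in>Basis. has_deriv2 (\<lambda>t. w (x + t *\<^sub>R b)) (e b)" "k = (\<Sum>b\<in>Basis. e b)"
    using assms unfolding has_laplacian_def by blast
  then show ?thesis
    by (intro has_laplacianI[where d = "\<lambda>b. d b + e b"]) (auto simp: sum.distrib has_deriv2_add)
qed

lemma has_laplacian_cmult:
  assumes "has_laplacian v l x"
  shows "has_laplacian (\<lambda>y. c * v y) (c * l) x"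
proof -
  obtain d where
    "\<forall>b\<in>Basis. has_deriv2 (\<lambda>t. v (x + t *\<^sub>R b)) (d b)" "l = (\<Sum>b\<in>Basis. d b)"
    using assms unfolding has_laplacian_def by blast
  then show ?thesis
    by (intro has_laplacianI[where d = "\<lambda>b. c * d b"]) (auto simp: sum_distrib_left has_deriv2_cmult)
qed

lemma has_laplacian_local_min:
  assumes "has_laplacian v l x" "\<forall>\<^sub>F y in nhds x. v x \<le> v y"
  shows "l \<ge> 0"
proof -
  obtain d where d: "\<And>b. b\<in>Basis \<Longrightarrow> has_deriv2 (\<lambda>t. v (x + t *\<^sub>R b)) (d b)" "l = (\<Sum>b\<in>Basis. d b)"
    using assms(1) unfolding has_laplacian_def by blast
  have "d b \<ge> 0" if "b \<in> Basis" for b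
  proof (rule has_deriv2_local_min[OF d(1)[OF that]])
    have "((\<lambda>t. x + t *\<^sub>R b) \<longlongrightarrow> x + 0 *\<^sub>R b) (nhds 0)"
      by (intro tendsto_intros filterlim_ident)
    then have "filterlim (\<lambda>t. x + t *\<^sub>R b) (nhds x) (nhds 0)" by simp
    then show "\<forall>\<^sub>F t in nhds 0. v (x + 0 *\<^sub>R b) \<le> v (x + t *\<^sub>R b)"
      using assms(2) by (auto dest: eventually_compose_filterlim)
  qed
  then show ?thesis using d(2) by (simp add: sum_nonneg)
qed

text \<open>The second derivative \<open>D\<^sup>2u(x)(v, w)\<close>, first along \<open>v\<close>, then along \<open>w\<close>.\<close>

definition directional_deriv2 :: "('a::euclidean_space \<Rightarrow> real) \<Rightarrow> 'a \<Rightarrow> 'a \<Rightarrow> 'a \<Rightarrow> real" where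
  "directional_deriv2 u x v w = frechet_derivative (\<lambda>y. frechet_derivative u (at y) v) (at x) w"

lemma C2_derivs:
  assumes "Ck_on 2 \<Omega> u" "x \<in> \<Omega>"
  shows "(u has_derivative frechet_derivative u (at x)) (at x)"
    and "((\<lambda>y. frechet_derivative u (at y) v) has_derivative directional_deriv2 u x v) (at x)"
  using assms unfolding directional_deriv2_def
  by (auto simp: numeral_2_eq_2 frechet_derivative_works[symmetric])

lemma has_real_derivative_along_line:
  assumes "(F has_derivative D) (at (x + t *\<^sub>R w))"
  shows "((\<lambda>s. F (x + s *\<^sub>R w)) has_real_derivative D w) (at t)"
proof -
  have "((\<lambda>s. x + s *\<^sub>R w) has_derivative (\<lambda>s. s *\<^sub>R w)) (at t)"
    by (auto intro!: derivative_eq_intros)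
  from has_derivative_compose[OF this assms]
  have "((\<lambda>s. F (x + s *\<^sub>R w)) has_derivative (\<lambda>s. D (s *\<^sub>R w))) (at t)" .
  moreover have "D (s *\<^sub>R w) = s * D w" for s
    using has_derivative_linear[OF assms] by (simp add: linear_scale)
  ultimately show ?thesis by (simp add: has_field_derivative_def mult.commute[of _ "D w"] )
qed

lemma eventually_in_open_line:
  fixes x :: "'a::real_normed_vector"
  assumes "open \<Omega>" "x \<in> \<Omega>"
  shows "\<forall>\<^sub>F t in nhds 0. x + t *\<^sub>R w \<in> \<Omega>"
proof -
  have "((\<lambda>t. x + t *\<^sub>R w) \<longlongrightarrow> x + 0 *\<^sub>R w) (nhds 0)"
    by (intro tendsto_intros filterlim_ident)
  then show ?thesis using assms topological_tendstoD by fastforce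
qed

lemma has_deriv2_along_line:
  assumes "open \<Omega>" "Ck_on 2 \<Omega> u" "x \<in> \<Omega>"
  shows "has_deriv2 (\<lambda>t. u (x + t *\<^sub>R w)) (directional_deriv2 u x w w)"
proof -
  have "\<forall>\<^sub>F t in nhds 0. ((\<lambda>t. u (x + t *\<^sub>R w)) has_real_derivative
      frechet_derivative u (at (x + t *\<^sub>R w)) w) (at t)"
    using eventually_in_open_line[OF assms(1,3), of w]
    by eventually_elim (rule has_real_derivative_along_line, rule C2_derivs(1)[OF assms(2)])
  moreover have "((\<lambda>t. frechet_derivative u (at (x + t *\<^sub>R w)) w) has_real_derivative
      directional_deriv2 u x w w) (at 0)"
    by (rule has_real_derivative_along_line) (use C2_derivs(2)[OF assms(2,3)] in simp)
  ultimately show ?thesis unfolding has_deriv2_def by (intro exI conjI)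
qed

lemma laplacian_eq: "laplacian u x = (\<Sum>b\<in>Basis. directional_deriv2 u x b b)"
  by (simp add: laplacian_def directional_deriv2_def)

lemma has_laplacian_laplacian:
  assumes "open \<Omega>" "Ck_on 2 \<Omega> u" "x \<in> \<Omega>"
  shows "has_laplacian u (laplacian u x) x"
  by (rule has_laplacianI[OF has_deriv2_along_line[OF assms]]) (simp add: laplacian_eq)

lemma directional_deriv2_linear_right:
  assumes "Ck_on 2 \<Omega> u" "x \<in> \<Omega>"
  shows "linear (directional_deriv2 u x v)"
  using has_derivative_linear[OF C2_derivs(2)[OF assms]] .

lemma directional_deriv2_left:
  assumes "open \<Omega>" "Ck_on 2 \<Omega> u" "x \<in> \<Omega>"
  shows "directional_deriv2 u x (v + c *\<^sub>R v') w =
    directional_deriv2 u x v w + c * directional_deriv2 u x v' w"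
proof -
  have "((\<lambda>y. frechet_derivative u (at y) v + c * frechet_derivative u (at y) v') has_derivative
      (\<lambda>w. directional_deriv2 u x v w + c * directional_deriv2 u x v' w)) (at x)"
    by (intro has_derivative_add has_derivative_mult_right C2_derivs(2)[OF assms(2,3)])
  moreover have "\<forall>\<^sub>F y in at x. frechet_derivative u (at y) v + c * frechet_derivative u (at y) v' =
      frechet_derivative u (at y) (v + c *\<^sub>R v')"
    using eventually_at_in_open'[OF assms(1,3)]
  proof eventually_elim
    case (elim y)
    then show ?case using has_derivative_linear[OF C2_derivs(1)[OF assms(2)]]
      by (simp add: linear_add linear_scale)
  qed
  ultimately have "((\<lambda>y. frechet_derivative u (at y) (v + c *\<^sub>R v')) has_derivative
      (\<lambda>w. directional_deriv2 u x v w + c * directional_deriv2 u x v' w)) (at x)"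
    using has_derivative_linear[OF C2_derivs(1)[OF assms(2,3)]]
    by (elim has_derivative_transform_eventually) (auto simp: linear_add linear_scale)
  then show ?thesis
    using has_derivative_unique[OF _ C2_derivs(2)[OF assms(2,3), of "v + c *\<^sub>R v'"]] by metis
qed

text \<open>The trace of the Hessian is invariant under a reflection. Only bilinearity of \<open>D\<^sup>2u(x)\<close> is used:
  on expanding \<open>reflect \<nu> b = b - 2(b \<bullet> \<nu>)\<nu>\<close> the terms in \<open>D\<^sup>2u(x)(\<nu>, \<nu>)\<close> cancel.\<close>

lemma sum_directional_deriv2_reflect:
  assumes "open \<Omega>" "Ck_on 2 \<Omega> u" "x \<in> \<Omega>" "norm \<nu> = 1"
  shows "(\<Sum>b\<in>Basis. directional_deriv2 u x (reflect \<nu> b) (reflect \<nu> b)) = laplacian u x"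
proof -
  let ?B = "directional_deriv2 u x"
  have r: "reflect \<nu> b = b + (- 2 * (b \<bullet> \<nu>)) *\<^sub>R \<nu>" for b by (simp add: reflect_def)
  have lin: "linear (?B v)" for v using directional_deriv2_linear_right[OF assms(2,3)] .
  have L: "?B (v + c *\<^sub>R v') w = ?B v w + c * ?B v' w" for v v' c w
    using directional_deriv2_left[OF assms(1-3)] .
  have R: "?B v (w + c *\<^sub>R w') = ?B v w + c * ?B v w'" for v w c w'
    using lin[of v] by (simp add: linear_add linear_scale)
  have S1: "(\<Sum>b\<in>Basis. (b \<bullet> \<nu>) * ?B \<nu> b) = ?B \<nu> \<nu>"
  proof -
    have "?B \<nu> \<nu> = ?B \<nu> (\<Sum>b\<in>Basis. (\<nu> \<bullet> b) *\<^sub>R b)" by (simp add: euclidean_representation)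
    also have "\<dots> = (\<Sum>b\<in>Basis. (\<nu> \<bullet> b) * ?B \<nu> b)"
      using lin[of \<nu>] by (simp add: linear_sum linear_scale)
    finally show ?thesis by (simp add: inner_commute)
  qed
  have S2: "(\<Sum>b\<in>Basis. (b \<bullet> \<nu>) * ?B b \<nu>) = ?B \<nu> \<nu>"
  proof -
    have z: "?B 0 w = 0" for w using L[of 0 1 0 w] by simp
    have sc: "?B (c *\<^sub>R v) w = c * ?B v w" for c v w using L[of 0 c v w] z by simp
    have ad: "?B (v + v') w = ?B v w + ?B v' w" for v v' w using L[of v 1 v' w] by simp
    have lin': "linear (\<lambda>v. ?B v \<nu>)" by (rule linearI) (auto simp: ad sc)
    have "?B \<nu> \<nu> = ?B (\<Sum>b\<in>Basis. (\<nu> \<bullet> b) *\<^sub>R b) \<nu>" by (simp add: euclidean_representation)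
    also have "\<dots> = (\<Sum>b\<in>Basis. (\<nu> \<bullet> b) * ?B b \<nu>)"
      using linear_sum[OF lin', of "\<lambda>b. (\<nu> \<bullet> b) *\<^sub>R b" Basis] by (simp add: sc)
    finally show ?thesis by (simp add: inner_commute)
  qed
  have S3: "(\<Sum>b\<in>Basis. (b \<bullet> \<nu>)\<^sup>2) = 1"
    using assms(4) euclidean_inner[of \<nu> \<nu>]
    by (simp add: power2_eq_square inner_commute norm_eq_1)
  have "?B (reflect \<nu> b) (reflect \<nu> b) =
      ?B b b - 2 * ((b \<bullet> \<nu>) * ?B b \<nu>) - 2 * ((b \<bullet> \<nu>) * ?B \<nu> b) + 4 * ?B \<nu> \<nu> * (b \<bullet> \<nu>)\<^sup>2" for b
    unfolding r L R by (simp add: algebra_simps power2_eq_square)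
  then have "(\<Sum>b\<in>Basis. ?B (reflect \<nu> b) (reflect \<nu> b)) =
      (\<Sum>b\<in>Basis. ?B b b) - 2 * (\<Sum>b\<in>Basis. (b \<bullet> \<nu>) * ?B b \<nu>)
        - 2 * (\<Sum>b\<in>Basis. (b \<bullet> \<nu>) * ?B \<nu> b) + 4 * ?B \<nu> \<nu> * (\<Sum>b\<in>Basis. (b \<bullet> \<nu>)\<^sup>2)"
    by (simp add: sum.distrib sum_subtractf sum_distrib_left)
  then show ?thesis unfolding S1 S2 S3 by (simp add: laplacian_eq)
qed

text \<open>Reflection in the hyperplane \<open>x \<bullet> \<nu> = \<tau>\<close>, for a unit vector \<open>\<nu>\<close>.\<close>

definition reflect_at :: "'a::euclidean_space \<Rightarrow> real \<Rightarrow> 'a \<Rightarrow> 'a" where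
  "reflect_at \<nu> \<tau> x = x + (2 * (\<tau> - x \<bullet> \<nu>)) *\<^sub>R \<nu>"

lemma has_laplacian_reflect_at:
  assumes "open \<Omega>" "Ck_on 2 \<Omega> u" "reflect_at \<nu> \<tau> x \<in> \<Omega>" "norm \<nu> = 1"
  shows "has_laplacian (\<lambda>y. u (reflect_at \<nu> \<tau> y)) (laplacian u (reflect_at \<nu> \<tau> x)) x"
proof (rule has_laplacianI)
  fix b :: 'a
  have "reflect_at \<nu> \<tau> (x + t *\<^sub>R b) = reflect_at \<nu> \<tau> x + t *\<^sub>R reflect \<nu> b" for t
    by (simp add: reflect_at_def reflect_def algebra_simps inner_add_left)
  then show "has_deriv2 (\<lambda>t. u (reflect_at \<nu> \<tau> (x + t *\<^sub>R b)))
      (directional_deriv2 u (reflect_at \<nu> \<tau> x) (reflect \<nu> b) (reflect \<nu> b))"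
    using has_deriv2_along_line[OF assms(1-3), of "reflect \<nu> b"] by simp
qed (rule sum_directional_deriv2_reflect[OF assms])

section \<open>Maximum principles\<close>

lemma has_laplacian_slab_barrier:
  assumes "norm \<nu> = 1"
  shows "has_laplacian (\<lambda>y. A - (y \<bullet> \<nu> - \<tau>)\<^sup>2) (-2) x"
proof (rule has_laplacianI)
  fix b :: 'a
  have "((\<lambda>t. A - ((x + t *\<^sub>R b) \<bullet> \<nu> - \<tau>)\<^sup>2) has_real_derivative
      - 2 * ((x + t *\<^sub>R b) \<bullet> \<nu> - \<tau>) * (b \<bullet> \<nu>)) (at t)" for t
    unfolding inner_add_left inner_scaleR_left
    by (auto intro!: derivative_eq_intros simp: algebra_simps)
  moreover have "((\<lambda>t. - 2 * ((x + t *\<^sub>R b) \<bullet> \<nu> - \<tau>) * (b \<bullet> \<nu>)) has_real_derivative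
      - 2 * (b \<bullet> \<nu>)\<^sup>2) (at 0)"
    unfolding inner_add_left inner_scaleR_left
    by (auto intro!: derivative_eq_intros simp: algebra_simps power2_eq_square)
  ultimately show "has_deriv2 (\<lambda>t. A - ((x + t *\<^sub>R b) \<bullet> \<nu> - \<tau>)\<^sup>2) (- 2 * (b \<bullet> \<nu>)\<^sup>2)"
    by (rule has_deriv2I)
next
  have "(\<Sum>b\<in>Basis. (b \<bullet> \<nu>)\<^sup>2) = 1"
    using assms euclidean_inner[of \<nu> \<nu>] by (simp add: power2_eq_square inner_commute norm_eq_1)
  then show "(\<Sum>b\<in>Basis. - 2 * (b \<bullet> \<nu>)\<^sup>2) = -2"
    by (simp add: sum_negf flip: sum_distrib_left)
qed

lemma has_laplacian_gaussian:
  fixes x y :: "'a::euclidean_space"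
  shows "has_laplacian (\<lambda>x. exp (- \<alpha> * (norm (x - y))\<^sup>2))
    (exp (- \<alpha> * (norm (x - y))\<^sup>2) * (4 * \<alpha>\<^sup>2 * (norm (x - y))\<^sup>2 - 2 * \<alpha> * DIM('a))) x"
proof (rule has_laplacianI)
  fix b :: 'a assume b: "b \<in> Basis"
  define z where "z = x - y"
  have eq: "(norm (x + t *\<^sub>R b - y))\<^sup>2 = z \<bullet> z + 2 * t * (z \<bullet> b) + t\<^sup>2" for t
  proof -
    have "x + t *\<^sub>R b - y = z + t *\<^sub>R b" by (simp add: z_def)
    then show ?thesis using b
      by (simp only: power2_norm_eq_inner)
         (simp add: inner_add_left inner_add_right inner_commute power2_eq_square)
  qed
  have norm_z: "(norm (x - y))\<^sup>2 = z \<bullet> z" by (simp add: power2_norm_eq_inner z_def)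
  let ?E = "\<lambda>t. exp (- \<alpha> * (z \<bullet> z + 2 * t * (z \<bullet> b) + t\<^sup>2))"
  have "(?E has_real_derivative ?E t * (- \<alpha> * (2 * (z \<bullet> b) + 2 * t))) (at t)" for t
    by (auto intro!: derivative_eq_intros simp: algebra_simps)
  moreover have "((\<lambda>t. ?E t * (- \<alpha> * (2 * (z \<bullet> b) + 2 * t))) has_real_derivative
      exp (- \<alpha> * (z \<bullet> z)) * (4 * \<alpha>\<^sup>2 * (z \<bullet> b)\<^sup>2 - 2 * \<alpha>)) (at 0)"
    by (auto intro!: derivative_eq_intros simp: algebra_simps power2_eq_square)
  ultimately have "has_deriv2 ?E
      (exp (- \<alpha> * (z \<bullet> z)) * (4 * \<alpha>\<^sup>2 * (z \<bullet> b)\<^sup>2 - 2 * \<alpha>))"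
    by (rule has_deriv2I)
  then show "has_deriv2 (\<lambda>t. exp (- \<alpha> * (norm (x + t *\<^sub>R b - y))\<^sup>2))
      (exp (- \<alpha> * (norm (x - y))\<^sup>2) * (4 * \<alpha>\<^sup>2 * ((x - y) \<bullet> b)\<^sup>2 - 2 * \<alpha>))"
    unfolding eq norm_z by (simp only: z_def)
next
  have "(\<Sum>b\<in>Basis. ((x - y) \<bullet> b)\<^sup>2) = (norm (x - y))\<^sup>2"
    using euclidean_inner[of "x - y" "x - y"] by (simp add: power2_eq_square power2_norm_eq_inner[unfolded power2_eq_square])
  then show "(\<Sum>b\<in>Basis. exp (- \<alpha> * (norm (x - y))\<^sup>2) * (4 * \<alpha>\<^sup>2 * ((x - y) \<bullet> b)\<^sup>2 - 2 * \<alpha>))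
      = exp (- \<alpha> * (norm (x - y))\<^sup>2) * (4 * \<alpha>\<^sup>2 * (norm (x - y))\<^sup>2 - 2 * \<alpha> * DIM('a))"
    by (simp add: sum_subtractf flip: sum_distrib_left)
qed

text \<open>Maximum principle in a narrow slab for \<open>\<Delta> w \<le> - L w\<close>, where the zeroth-order term has the bad
  sign. The differential inequality is needed only at negative values of \<open>w\<close>. The positive function
  \<open>\<phi>(y) = 1 / (L + 1) - (y \<bullet> \<nu> - \<tau>)\<^sup>2\<close> satisfies \<open>\<Delta> \<phi> = -2 < - L \<phi>\<close>; at a negative minimum of
  \<open>w / \<phi>\<close> this is contradictory.\<close>

lemma slab_maximum_principle:
  fixes w :: "'a::euclidean_space \<Rightarrow> real"
  assumes K: "compact K" "continuous_on K w" and \<nu>: "norm \<nu> = 1" and L: "L \<ge> 0"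
    and slab: "\<And>x. x \<in> K \<Longrightarrow> (L + 1) * (x \<bullet> \<nu> - \<tau>)\<^sup>2 < 1"
    and neg: "\<And>x. x \<in> K \<Longrightarrow> w x < 0 \<Longrightarrow>
      x \<in> interior K \<and> (\<exists>l. has_laplacian w l x \<and> l \<le> - L * w x)"
    and "x \<in> K"
  shows "w x \<ge> 0"
proof (rule ccontr)
  assume "\<not> w x \<ge> 0"
  define \<phi> where "\<phi> = (\<lambda>y. 1 / (L + 1) - (y \<bullet> \<nu> - \<tau>)\<^sup>2)"
  have pos: "\<phi> y > 0" if "y \<in> K" for y
    using slab[OF that] L by (simp add: \<phi>_def field_simps)
  have "continuous_on K (\<lambda>y. w y / \<phi> y)"
    using pos unfolding \<phi>_def by (intro continuous_intros K(2)) fastforce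
  then obtain z where z: "z \<in> K" "\<And>y. y \<in> K \<Longrightarrow> w z / \<phi> z \<le> w y / \<phi> y"
    using continuous_attains_inf[OF K(1)] \<open>x \<in> K\<close> by blast
  define q where "q = w z / \<phi> z"
  have "w x / \<phi> x < 0" using \<open>\<not> w x \<ge> 0\<close> pos[OF \<open>x \<in> K\<close>] by (simp add: divide_neg_pos)
  then have q: "q < 0" using z(2)[OF \<open>x \<in> K\<close>] q_def by linarith
  have wz: "w z = q * \<phi> z" using pos[OF z(1)] by (simp add: q_def)
  then have "w z < 0" using q pos[OF z(1)] by (simp add: mult_neg_pos)
  then obtain l where l: "z \<in> interior K" "has_laplacian w l z" "l \<le> - L * w z"
    using neg[OF z(1)] by blast
  have v: "w y + - q * \<phi> y \<ge> 0" if "y \<in> K" for y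
    using z(2)[OF that] pos[OF that] unfolding q_def[symmetric] by (simp add: le_divide_eq)
  \<comment> \<open>\<open>w - q \<phi>\<close> is nonnegative on \<open>K\<close> and vanishes at \<open>z\<close>\<close>
  have "has_laplacian (\<lambda>y. w y + - q * \<phi> y) (l + - q * (-2)) z"
    unfolding \<phi>_def by (intro has_laplacian_add has_laplacian_cmult has_laplacian_slab_barrier l(2) \<nu>)
  moreover have "\<forall>\<^sub>F y in nhds z. w z + - q * \<phi> z \<le> w y + - q * \<phi> y"
  proof -
    have "\<forall>\<^sub>F y in nhds z. y \<in> interior K"
      using l(1) by (intro eventually_nhds_in_open) auto
    then show ?thesis
      by eventually_elim (use v wz interior_subset in force)
  qed
  ultimately have "l + - q * (-2) \<ge> 0" by (rule has_laplacian_local_min)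
  moreover have "l \<le> - q"
  proof -
    have "L * \<phi> z \<le> L * (1 / (L + 1))"
      using L by (intro mult_left_mono) (auto simp: \<phi>_def)
    also have "\<dots> \<le> 1" using L by (simp add: field_simps)
    finally have "- q * (L * \<phi> z) \<le> - q * 1" using q by (intro mult_left_mono) auto
    then show ?thesis using l(3) wz by (simp add: mult.left_commute)
  qed
  ultimately show False using q by linarith
qed

text \<open>Positivity at the centre spreads to the whole ball. The barrier is the difference of Gaussians in
  Hopf's lemma, \<open>exp (- \<alpha> |x - y|\<^sup>2) - exp (- \<alpha> R\<^sup>2)\<close>, on the annulus between a small ball on which
  \<open>w \<ge> w y / 2\<close> and the sphere of radius \<open>R\<close>.\<close>

lemma strong_maximum_principle_ball:
  fixes w :: "'a::euclidean_space \<Rightarrow> real"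
  assumes cont: "continuous_on (cball y R) w"
    and nonneg: "\<And>x. x \<in> cball y R \<Longrightarrow> w x \<ge> 0" and wy: "w y > 0" and C: "C > 0"
    and lap: "\<And>x. x \<in> ball y R \<Longrightarrow> \<exists>l. has_laplacian w l x \<and> l \<le> C * w x"
    and x: "x \<in> ball y R"
  shows "w x > 0"
proof -
  have R: "R > 0" using x by (auto intro: le_less_trans[OF zero_le_dist])
  define m where "m = w y / 2"
  have m: "m > 0" using wy by (simp add: m_def)
  obtain d where d: "d > 0" "\<And>x. x \<in> cball y R \<Longrightarrow> dist x y < d \<Longrightarrow> dist (w x) (w y) < m"
    using cont m R unfolding continuous_on_iff by (metis centre_in_cball less_imp_le)
  define \<rho> where "\<rho> = min d R / 2"
  have \<rho>: "0 < \<rho>" "\<rho> < R" "\<rho> < d" using d(1) R by (auto simp: \<rho>_def min_def)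
  have inner: "w x \<ge> m" if "dist y x \<le> \<rho>" for x
  proof -
    have "dist (w x) (w y) < m" using that \<rho> by (intro d(2)) (auto simp: dist_commute)
    then show ?thesis unfolding dist_real_def m_def by argo
  qed
  \<comment> \<open>large enough for \<open>\<Delta> E \<ge> C E\<close> outside the ball of radius \<open>\<rho>\<close>\<close>
  define \<alpha> where "\<alpha> = (2 * DIM('a) + C) / (4 * \<rho>\<^sup>2) + 1"
  have \<alpha>: "\<alpha> \<ge> 1" using C by (simp add: \<alpha>_def)
  have \<alpha>\<rho>: "4 * \<alpha> * \<rho>\<^sup>2 \<ge> 2 * DIM('a) + C"
    using \<rho>(1) by (simp add: \<alpha>_def field_simps)
  define E where "E = (\<lambda>x. exp (- \<alpha> * (norm (x - y))\<^sup>2))"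
  define h where "h = (\<lambda>x. E x - exp (- \<alpha> * R\<^sup>2))"
  have E_le: "E x \<le> 1" for x using \<alpha> by (simp add: E_def)
  have h_lt: "h x < E x" for x by (simp add: h_def)
  let ?A = "cball y R - ball y \<rho>"
  have comparison: "w x \<ge> m * h x" if xA: "x \<in> ?A" for x
  proof (rule ccontr)
    assume neg: "\<not> w x \<ge> m * h x"
    have "compact ?A" by (intro compact_diff) auto
    moreover have "continuous_on ?A (\<lambda>x. w x - m * h x)"
      unfolding h_def E_def by (intro continuous_intros continuous_on_subset[OF cont]) auto
    ultimately obtain z where z: "z \<in> ?A" "\<And>x. x \<in> ?A \<Longrightarrow> w z - m * h z \<le> w x - m * h x"
      using continuous_attains_inf[of ?A] xA by blast
    have wz: "w z < m * h z" using neg z(2)[OF xA] by linarith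
    have "dist y z \<noteq> R"
    proof
      assume "dist y z = R"
      then have "h z = 0" by (simp add: h_def E_def dist_norm norm_minus_commute)
      then show False using wz nonneg[of z] z(1) by auto
    qed
    moreover have "dist y z \<noteq> \<rho>"
    proof
      assume "dist y z = \<rho>"
      then have "w z \<ge> m" by (intro inner) auto
      moreover have "m * h z \<le> m * 1"
        using m h_lt[of z] E_le[of z] by (intro mult_left_mono) auto
      ultimately show False using wz by auto
    qed
    ultimately have zi: "\<rho> < dist y z" "dist y z < R" using z(1) by auto
    then obtain l where l: "has_laplacian w l z" "l \<le> C * w z" using lap[of z] by auto
    define k where "k = E z * (4 * \<alpha>\<^sup>2 * (norm (z - y))\<^sup>2 - 2 * \<alpha> * DIM('a))"
    have "has_laplacian (\<lambda>x. w x + - m * E x) (l + - m * k) z"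
      unfolding E_def k_def by (intro has_laplacian_add has_laplacian_cmult has_laplacian_gaussian l)
    moreover have "\<forall>\<^sub>F x in nhds z. w z + - m * E z \<le> w x + - m * E x"
    proof -
      have "\<forall>\<^sub>F x in nhds z. x \<in> ball y R - cball y \<rho>"
        using zi by (intro eventually_nhds_in_open) auto
      then show ?thesis
      proof eventually_elim
        case (elim x)
        then have "x \<in> ?A" by auto
        from z(2)[OF this] show ?case by (simp add: h_def algebra_simps)
      qed
    qed
    ultimately have "l + - m * k \<ge> 0" by (rule has_laplacian_local_min)
    moreover have "k \<ge> C * E z"
    proof -
      have "\<rho>\<^sup>2 \<le> (norm (z - y))\<^sup>2"
        using zi \<rho> by (intro power_mono) (auto simp: dist_norm norm_minus_commute)
      then have "\<alpha> * (4 * \<alpha> * \<rho>\<^sup>2) \<le> \<alpha> * (4 * \<alpha> * (norm (z - y))\<^sup>2)"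
        using \<alpha> by (intro mult_left_mono) auto
      moreover have "\<alpha> * (2 * DIM('a) + C) \<le> \<alpha> * (4 * \<alpha> * \<rho>\<^sup>2)"
        using \<alpha> \<alpha>\<rho> by (intro mult_left_mono) auto
      moreover have "1 * C \<le> \<alpha> * C" using \<alpha> C by (intro mult_right_mono) auto
      ultimately have "C \<le> 4 * \<alpha>\<^sup>2 * (norm (z - y))\<^sup>2 - 2 * \<alpha> * DIM('a)"
        by (simp add: algebra_simps power2_eq_square)
      then have "E z * C \<le> k" unfolding k_def by (intro mult_left_mono) (auto simp: E_def)
      then show ?thesis by (simp add: mult.commute)
    qed
    moreover have "C * w z < C * (m * E z)"
      using C wz m h_lt[of z] by (intro mult_strict_left_mono) (auto intro: less_trans)
    moreover have "m * k \<ge> m * (C * E z)" using \<open>k \<ge> C * E z\<close> m by simp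
    ultimately show False using l(2) by (simp add: mult.left_commute)
  qed
  show ?thesis
  proof (cases "dist y x \<le> \<rho>")
    case True
    then show ?thesis using inner m by fastforce
  next
    case False
    have "(norm (x - y))\<^sup>2 < R\<^sup>2"
      using x by (intro power_strict_mono) (auto simp: dist_norm norm_minus_commute)
    then have "h x > 0" using \<alpha> by (simp add: h_def E_def)
    moreover have "w x \<ge> m * h x" using False x by (intro comparison) auto
    ultimately show ?thesis using m by (meson mult_pos_pos less_le_trans)
  qed
qed

section \<open>Moving planes\<close>

lemma lipschitz_increment_bound:
  assumes "locally_lipschitz_on {0..} f"
  shows "\<exists>L\<ge>0. \<forall>s t. 0 \<le> s \<and> s \<le> t \<and> t \<le> M \<longrightarrow> f t - f s \<le> L * (t - s)"
proof -
  have loc: "local_lipschitz {0::real} {0..M} (\<lambda>_. f)"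
  proof (rule local_lipschitzI)
    fix t x :: real assume x: "x \<in> {0..M}"
    then have "x \<in> {0..}" by simp
    then obtain \<delta> L where \<delta>: "\<delta> > 0" "L-lipschitz_on (ball x \<delta> \<inter> {0..}) f"
      using assms unfolding locally_lipschitz_on_def by blast
    have "L-lipschitz_on (cball x (\<delta> / 2) \<inter> {0..M}) f"
      by (rule lipschitz_on_subset[OF \<delta>(2)]) (use \<delta>(1) in auto)
    then show "\<exists>u>0. \<exists>L. \<forall>t\<in>cball t u \<inter> {0}. L-lipschitz_on (cball x u \<inter> {0..M}) f"
      using \<delta>(1) half_gt_zero by blast
  qed
  obtain L where L: "L-lipschitz_on {0..M} f"
  proof (rule local_lipschitz_compact_implies_lipschitz[OF loc])
    fix L assume "\<And>t. t \<in> {0::real} \<Longrightarrow> L-lipschitz_on {0..M} f"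
    from this[of 0] show thesis by (intro that) simp
  qed simp_all
  have "f t - f s \<le> L * (t - s)" if "0 \<le> s" "s \<le> t" "t \<le> M" for s t
    using lipschitz_onD[OF L, of t s] that by (auto simp: dist_real_def)
  moreover have "L \<ge> 0" using L by (rule lipschitz_on_nonneg)
  ultimately show ?thesis by blast
qed

lemma inverse_powr_increment_bound:
  fixes \<gamma> m s t :: real
  assumes "\<gamma> > 0" "0 < m" "m \<le> s" "s \<le> t"
  shows "1 / (s powr \<gamma>) - 1 / (t powr \<gamma>) \<le> \<gamma> * m powr (- \<gamma> - 1) * (t - s)"
proof (cases "s = t")
  case False
  then have "s < t" using assms by simp
  have "((\<lambda>x. x powr (- \<gamma>)) has_real_derivative - \<gamma> * x powr (- \<gamma> - 1)) (at x)"
    if "s \<le> x" "x \<le> t" for x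
    using has_real_derivative_powr[of x "- \<gamma>"] that assms by simp
  from MVT2[OF \<open>s < t\<close> this] obtain z where
    z: "s < z" "z < t" "t powr (- \<gamma>) - s powr (- \<gamma>) = (t - s) * (- \<gamma> * z powr (- \<gamma> - 1))"
    by blast
  have "z powr (- \<gamma> - 1) \<le> m powr (- \<gamma> - 1)"
    using z assms by (intro powr_mono2') auto
  then have "(t - s) * (\<gamma> * z powr (- \<gamma> - 1)) \<le> (t - s) * (\<gamma> * m powr (- \<gamma> - 1))"
    using assms by (intro mult_left_mono) auto
  then have "s powr (- \<gamma>) - t powr (- \<gamma>) \<le> (t - s) * (\<gamma> * m powr (- \<gamma> - 1))"
    using z(3) by linarith
  then show ?thesis by (simp only: powr_minus_divide mult.commute)
qed simp

lemma reflect_at_hyperplane: "x \<bullet> \<nu> = \<tau> \<Longrightarrow> reflect_at \<nu> \<tau> x = x"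
  by (simp add: reflect_at_def)

lemma dist_reflect_at:
  assumes "norm \<nu> = 1"
  shows "dist (reflect_at \<nu> \<tau> x) (reflect_at \<nu> \<sigma> x) = 2 * \<bar>\<tau> - \<sigma>\<bar>"
proof -
  have "reflect_at \<nu> \<tau> x - reflect_at \<nu> \<sigma> x = (2 * (\<tau> - \<sigma>)) *\<^sub>R \<nu>"
    by (simp add: reflect_at_def algebra_simps)
  then have "dist (reflect_at \<nu> \<tau> x) (reflect_at \<nu> \<sigma> x) = \<bar>2 * (\<tau> - \<sigma>)\<bar>"
    using assms by (simp only: dist_norm norm_scaleR)
  then show ?thesis by (simp only: abs_mult)
qed

text \<open>A solution \<open>u\<close> and a direction \<open>\<nu>\<close> along which the hyperplanes \<open>x \<bullet> \<nu> = \<tau>\<close> can be moved up to the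
  final position \<open>\<tau> = a\<close>. The geometry of the domain enters only through \<open>reflect_in\<close>. For
  points \<open>x\<close> of the boundary, it says that \<open>R\<^sub>\<tau> x\<close> is an interior point.\<close>

locale moving_planes =
  fixes \<gamma> :: real and f :: "real \<Rightarrow> real" and \<Omega> :: "'a::euclidean_space set"
    and u :: "'a \<Rightarrow> real" and \<nu> :: 'a and a :: real
  assumes \<gamma>_pos: "\<gamma> > 0"
    and open_dom: "open \<Omega>" and bounded_dom: "bounded \<Omega>"
    and lipschitz: "locally_lipschitz_on {0..} f" and mono: "mono_on {0..} f"
    and solution: "singular_solution \<gamma> f \<Omega> u"
    and unit: "norm \<nu> = 1"
    and reflect_in:
      "\<And>x \<tau>. x \<in> closure \<Omega> \<Longrightarrow> x \<bullet> \<nu> < \<tau> \<Longrightarrow> \<tau> < a \<Longrightarrow> reflect_at \<nu> \<tau> x \<in> \<Omega>"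
begin

lemma compact_closure_dom: "compact (closure \<Omega>)"
  using bounded_dom by (simp add: compact_closure)

lemma continuous_u: "continuous_on (closure \<Omega>) u"
  and C2_u: "Ck_on 2 \<Omega> u"
  and u_pos: "x \<in> \<Omega> \<Longrightarrow> u x > 0"
  and laplacian_u: "x \<in> \<Omega> \<Longrightarrow> laplacian u x = - (1 / (u x powr \<gamma>) + f (u x))"
  using solution unfolding singular_solution_def by (auto simp: minus_equation_iff)

lemma u_boundary: "x \<in> closure \<Omega> \<Longrightarrow> x \<notin> \<Omega> \<Longrightarrow> u x = 0"
  using solution open_dom unfolding singular_solution_def
  by (auto simp: frontier_def interior_open)

lemma reflect_in_closure:
  assumes "x \<in> closure \<Omega>" "x \<bullet> \<nu> \<le> \<tau>" "\<tau> \<le> a"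
  shows "reflect_at \<nu> \<tau> x \<in> closure \<Omega>"
proof (cases "x \<bullet> \<nu> = \<tau>")
  case True
  then show ?thesis using assms by (simp add: reflect_at_hyperplane)
next
  case False
  let ?S = "{x \<bullet> \<nu> <..< \<tau>}"
  have "(\<lambda>\<sigma>. reflect_at \<nu> \<sigma> x) ` closure ?S \<subseteq> closure \<Omega>"
  proof (rule image_closure_subset)
    show "continuous_on (closure ?S) (\<lambda>\<sigma>. reflect_at \<nu> \<sigma> x)"
      unfolding reflect_at_def by (intro continuous_intros)
    show "(\<lambda>\<sigma>. reflect_at \<nu> \<sigma> x) ` ?S \<subseteq> closure \<Omega>"
      using reflect_in[OF assms(1)] assms closure_subset by fastforce
  qed auto
  then show ?thesis using False assms by auto
qed

text \<open>The difference \<open>w\<^sub>\<tau> = u \<circ> R\<^sub>\<tau> - u\<close>.\<close>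

definition gap :: "real \<Rightarrow> 'a \<Rightarrow> real" where
  "gap \<tau> x = u (reflect_at \<nu> \<tau> x) - u x"

lemma gap_hyperplane: "x \<bullet> \<nu> = \<tau> \<Longrightarrow> gap \<tau> x = 0"
  by (simp add: gap_def reflect_at_hyperplane)

lemma continuous_gap:
  assumes "\<tau> \<le> a"
  shows "continuous_on (closure \<Omega> \<inter> {x. x \<bullet> \<nu> \<le> \<tau>}) (gap \<tau>)"
  unfolding gap_def
proof (intro continuous_intros)
  show "continuous_on (closure \<Omega> \<inter> {x. x \<bullet> \<nu> \<le> \<tau>}) (\<lambda>x. u (reflect_at \<nu> \<tau> x))"
    by (rule continuous_on_compose2[OF continuous_u])
       (use reflect_in_closure assms in \<open>auto simp: reflect_at_def intro!: continuous_intros\<close>)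
qed (auto intro: continuous_on_subset[OF continuous_u])

lemma gap_boundary_pos:
  assumes "x \<in> closure \<Omega>" "x \<notin> \<Omega>" "x \<bullet> \<nu> < \<tau>" "\<tau> < a"
  shows "gap \<tau> x > 0"
  using u_pos[OF reflect_in] u_boundary assms by (simp add: gap_def)

lemma has_laplacian_gap:
  assumes "x \<in> \<Omega>" "x \<bullet> \<nu> < \<tau>" "\<tau> < a"
  shows "has_laplacian (gap \<tau>)
    (1 / (u x powr \<gamma>) + f (u x) - (1 / (u (reflect_at \<nu> \<tau> x) powr \<gamma>) + f (u (reflect_at \<nu> \<tau> x)))) x"
proof -
  have r: "reflect_at \<nu> \<tau> x \<in> \<Omega>"
    using reflect_in assms closure_subset by blast
  have "has_laplacian (\<lambda>y. u (reflect_at \<nu> \<tau> y) + -1 * u y)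
      (laplacian u (reflect_at \<nu> \<tau> x) + -1 * laplacian u x) x"
    by (intro has_laplacian_add has_laplacian_cmult has_laplacian_reflect_at[OF open_dom C2_u r unit]
        has_laplacian_laplacian[OF open_dom C2_u assms(1)])
  then show ?thesis
    by (simp add: laplacian_u[OF r] laplacian_u[OF assms(1)] gap_def[abs_def] algebra_simps)
qed

lemma compact_slab:
  "compact (closure \<Omega> \<inter> {x. x \<bullet> \<nu> \<le> \<tau>})" "compact (closure \<Omega> \<inter> {x. \<mu> \<le> x \<bullet> \<nu> \<and> x \<bullet> \<nu> \<le> \<tau>})"
  by (intro compact_Int_closed compact_closure_dom closed_Collect_conj closed_Collect_le
      continuous_intros)+

text \<open>The plane can be advanced by \<open>\<delta>\<close> beyond a region where \<open>w\<^sub>\<tau> \<ge> 0\<close> is known; \<open>\<delta>\<close> depends only on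
  the Lipschitz constant of \<open>f\<close> on the range of \<open>u\<close>.\<close>

lemma gap_nonneg_extend:
  shows "\<exists>\<delta>>0. \<forall>\<mu> \<tau>. \<tau> < a \<and> \<mu> \<le> \<tau> \<and> \<tau> - \<mu> \<le> \<delta> \<and>
      (\<forall>x\<in>closure \<Omega>. x \<bullet> \<nu> \<le> \<mu> \<longrightarrow> gap \<tau> x \<ge> 0) \<longrightarrow>
      (\<forall>x\<in>closure \<Omega>. x \<bullet> \<nu> \<le> \<tau> \<longrightarrow> gap \<tau> x \<ge> 0)"
proof -
  have "bdd_above (u ` closure \<Omega>)"
    by (intro bounded_imp_bdd_above compact_imp_bounded compact_continuous_image
        continuous_u compact_closure_dom)
  then obtain M where M: "\<And>x. x \<in> closure \<Omega> \<Longrightarrow> u x \<le> M"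
    by (auto simp: bdd_above_def)
  obtain L where L: "L \<ge> 0"
      "\<forall>s t. 0 \<le> s \<and> s \<le> t \<and> t \<le> M \<longrightarrow> f t - f s \<le> L * (t - s)"
    using lipschitz_increment_bound[OF lipschitz] by blast
  define \<delta> where "\<delta> = 1 / (L + 2)"
  have "(L + 1) * 1 < (L + 2) * (L + 2)" using L(1) by (intro mult_strict_mono) auto
  then have "(L + 1) / ((L + 2) * (L + 2)) < 1" using L(1) by (simp only: divide_less_eq_1) simp
  then have \<delta>: "\<delta> > 0" "(L + 1) * \<delta>\<^sup>2 < 1"
    using L(1) by (simp_all add: \<delta>_def power2_eq_square)
  show ?thesis
  proof (intro exI[of _ \<delta>] conjI \<delta>(1) allI impI ballI)
    fix \<mu> \<tau> x
    assume "\<tau> < a \<and> \<mu> \<le> \<tau> \<and> \<tau> - \<mu> \<le> \<delta> \<and>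
      (\<forall>x\<in>closure \<Omega>. x \<bullet> \<nu> \<le> \<mu> \<longrightarrow> gap \<tau> x \<ge> 0)"
    then have \<tau>: "\<tau> < a" "\<mu> \<le> \<tau>" "\<tau> - \<mu> \<le> \<delta>"
      and below: "\<forall>x\<in>closure \<Omega>. x \<bullet> \<nu> \<le> \<mu> \<longrightarrow> gap \<tau> x \<ge> 0" by auto
    assume x: "x \<in> closure \<Omega>" "x \<bullet> \<nu> \<le> \<tau>"
    let ?K = "closure \<Omega> \<inter> {x. \<mu> \<le> x \<bullet> \<nu> \<and> x \<bullet> \<nu> \<le> \<tau>}"
    show "gap \<tau> x \<ge> 0"
    proof (cases "x \<bullet> \<nu> \<le> \<mu>")
      case True
      then show ?thesis using below x by blast
    next
      case False
      show ?thesis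
      proof (rule slab_maximum_principle[OF compact_slab(2) _ unit L(1)])
        show "continuous_on ?K (gap \<tau>)"
          by (rule continuous_on_subset[OF continuous_gap]) (use \<tau> in auto)
        show "(L + 1) * (z \<bullet> \<nu> - \<tau>)\<^sup>2 < 1" if "z \<in> ?K" for z
        proof -
          have "(z \<bullet> \<nu> - \<tau>)\<^sup>2 \<le> \<delta>\<^sup>2"
            using that \<tau> \<delta>(1) by (simp add: abs_le_square_iff[symmetric])
          then have "(L + 1) * (z \<bullet> \<nu> - \<tau>)\<^sup>2 \<le> (L + 1) * \<delta>\<^sup>2"
            using L(1) by (intro mult_left_mono) auto
          then show ?thesis using \<delta>(2) by linarith
        qed
        show "z \<in> interior ?K \<and> (\<exists>l. has_laplacian (gap \<tau>) l z \<and> l \<le> - L * gap \<tau> z)"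
          if z: "z \<in> ?K" "gap \<tau> z < 0" for z
        proof -
          have "z \<bullet> \<nu> \<noteq> \<tau>" using z(2) gap_hyperplane[of z \<tau>] by auto
          then have z_lt: "z \<bullet> \<nu> < \<tau>" using z(1) by auto
          have "\<mu> < z \<bullet> \<nu>" using below z by force
          have zO: "z \<in> \<Omega>" using gap_boundary_pos[of z \<tau>] z z_lt \<tau>(1) by auto
          let ?U = "\<Omega> \<inter> {x. \<mu> < x \<bullet> \<nu> \<and> x \<bullet> \<nu> < \<tau>}"
          have "open ?U"
            by (intro open_Int open_dom open_Collect_conj open_Collect_less continuous_intros)
          moreover have "?U \<subseteq> ?K" using closure_subset by force
          moreover have "z \<in> ?U" using zO z_lt \<open>\<mu> < z \<bullet> \<nu>\<close> by auto
          ultimately have int: "z \<in> interior ?K" by (meson interiorI)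
          define s t where "s = u (reflect_at \<nu> \<tau> z)" and "t = u z"
          have s: "0 < s" unfolding s_def using z z_lt \<tau>(1) by (intro u_pos reflect_in) auto
          have st: "s < t" using z(2) by (simp add: gap_def s_def t_def)
          have "t \<le> M" using M z by (auto simp: t_def)
          then have "f t - f s \<le> L * (t - s)" using L(2) s st by (simp add: less_imp_le)
          \<comment> \<open>the singular term has the good sign because \<open>u \<circ> R\<^sub>\<tau> < u\<close> at \<open>z\<close>\<close>
          moreover have "1 / (t powr \<gamma>) \<le> 1 / (s powr \<gamma>)"
            using s st \<gamma>_pos by (intro divide_left_mono powr_mono2) auto
          ultimately have "1 / (t powr \<gamma>) + f t - (1 / (s powr \<gamma>) + f s) \<le> - L * gap \<tau> z"
            by (simp add: gap_def s_def[symmetric] t_def[symmetric] algebra_simps)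
          then show ?thesis
            using int has_laplacian_gap[OF zO z_lt \<tau>(1)] unfolding s_def t_def by blast
        qed
        show "x \<in> ?K" using x False by auto
      qed
    qed
  qed
qed

text \<open>No connectedness is needed. Among the zeros of \<open>w\<^sub>\<tau>\<close> with \<open>z \<bullet> \<nu> \<le> x \<bullet> \<nu>\<close> take a lowest one; it
  is interior, and \<open>w\<^sub>\<tau> > 0\<close> just below it, so the strong maximum principle on a ball centred
  slightly below it is violated.\<close>

lemma gap_strictly_pos:
  assumes \<tau>: "\<tau> < a" and nonneg: "\<forall>x\<in>closure \<Omega>. x \<bullet> \<nu> \<le> \<tau> \<longrightarrow> gap \<tau> x \<ge> 0"
    and x: "x \<in> closure \<Omega>" "x \<bullet> \<nu> < \<tau>"
  shows "gap \<tau> x > 0"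
proof (rule ccontr)
  assume "\<not> gap \<tau> x > 0"
  moreover have "gap \<tau> x \<ge> 0" using nonneg x by simp
  ultimately have gx: "gap \<tau> x = 0" by simp
  let ?K = "closure \<Omega> \<inter> {z. z \<bullet> \<nu> \<le> x \<bullet> \<nu>}"
  define Z where "Z = {z \<in> ?K. gap \<tau> z = 0}"
  have "continuous_on ?K (gap \<tau>)"
    by (rule continuous_on_subset[OF continuous_gap]) (use \<tau> x in auto)
  then have "closed Z"
    unfolding Z_def
    by (rule continuous_closed_preimage_constant[OF _ compact_imp_closed[OF compact_slab(1)]])
  then have "compact (closure \<Omega> \<inter> Z)" by (rule compact_Int_closed[OF compact_closure_dom])
  moreover have "closure \<Omega> \<inter> Z = Z" by (auto simp: Z_def)
  ultimately have "compact Z" by simp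
  moreover have "Z \<noteq> {}" using x gx by (auto simp: Z_def)
  moreover have "continuous_on Z (\<lambda>z. z \<bullet> \<nu>)" by (intro continuous_intros)
  ultimately obtain z where z: "z \<in> Z" "\<And>y. y \<in> Z \<Longrightarrow> z \<bullet> \<nu> \<le> y \<bullet> \<nu>"
    using continuous_attains_inf[of Z "\<lambda>z. z \<bullet> \<nu>"] by blast
  have zK: "z \<in> closure \<Omega>" "z \<bullet> \<nu> \<le> x \<bullet> \<nu>" "gap \<tau> z = 0" using z(1) by (auto simp: Z_def)
  let ?D = "\<Omega> \<inter> {y. y \<bullet> \<nu> < \<tau>}"
  have "z \<in> ?D" using gap_boundary_pos[of z \<tau>] zK x \<tau> by auto
  moreover have "open ?D" by (intro open_Int open_dom open_Collect_less continuous_intros)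
  ultimately obtain e where e: "e > 0" "cball z e \<subseteq> ?D" by (meson open_contains_cball)
  define r where "r = e / 3"
  have r: "r > 0" using e by (simp add: r_def)
  define y where "y = z - r *\<^sub>R \<nu>"
  have dist_yz: "dist y z = r" using r unit by (simp add: y_def dist_norm)
  have sub: "cball y (2 * r) \<subseteq> ?D"
  proof
    fix p assume "p \<in> cball y (2 * r)"
    then have "p \<in> cball z e"
      using dist_yz dist_triangle[of z p y] by (simp add: r_def dist_commute)
    then show "p \<in> ?D" using e(2) by blast
  qed
  have sub_closure: "cball y (2 * r) \<subseteq> closure \<Omega> \<inter> {y. y \<bullet> \<nu> \<le> \<tau>}"
  proof -
    have "?D \<subseteq> closure \<Omega> \<inter> {y. y \<bullet> \<nu> \<le> \<tau>}" using closure_subset[of \<Omega>] by auto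
    with sub show ?thesis by (rule subset_trans)
  qed
  have ball_nonneg: "gap \<tau> p \<ge> 0" if "p \<in> cball y (2 * r)" for p
    using sub_closure that nonneg by blast
  have "y \<in> cball y (2 * r)" using r by simp
  have "y \<bullet> \<nu> < z \<bullet> \<nu>"
    using r unit by (simp add: y_def inner_diff_left norm_eq_1)
  then have "y \<notin> Z" using z(2)[of y] by linarith
  moreover have "y \<in> closure \<Omega>" using sub \<open>y \<in> cball y (2 * r)\<close> closure_subset by blast
  ultimately have "gap \<tau> y \<noteq> 0" using \<open>y \<bullet> \<nu> < z \<bullet> \<nu>\<close> zK(2) by (auto simp: Z_def)
  then have gy: "gap \<tau> y > 0" using ball_nonneg[OF \<open>y \<in> cball y (2 * r)\<close>] by simp
  have "continuous_on (cball y (2 * r)) u"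
    using sub_closure by (intro continuous_on_subset[OF continuous_u]) auto
  then obtain p where p: "p \<in> cball y (2 * r)" "\<And>q. q \<in> cball y (2 * r) \<Longrightarrow> u p \<le> u q"
    using continuous_attains_inf[OF compact_cball, of y "2 * r" u] \<open>y \<in> cball y (2 * r)\<close> by blast
  have up: "u p > 0" using p(1) sub by (intro u_pos) auto
  define C where "C = \<gamma> * u p powr (- \<gamma> - 1)"
  have "gap \<tau> z > 0"
  proof (rule strong_maximum_principle_ball[where w = "gap \<tau>" and y = y and R = "2 * r" and C = C])
    show "continuous_on (cball y (2 * r)) (gap \<tau>)"
      using continuous_on_subset[OF continuous_gap sub_closure] \<tau> by simp
    show "gap \<tau> p \<ge> 0" if "p \<in> cball y (2 * r)" for p by (rule ball_nonneg[OF that])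
    show "gap \<tau> y > 0" by (rule gy)
    show "C > 0" using \<gamma>_pos up by (simp add: C_def)
    show "\<exists>l. has_laplacian (gap \<tau>) l q \<and> l \<le> C * gap \<tau> q" if q: "q \<in> ball y (2 * r)" for q
    proof -
      have qc: "q \<in> cball y (2 * r)" using q by auto
      then have qD: "q \<in> \<Omega>" "q \<bullet> \<nu> < \<tau>" using sub by auto
      define s t where "s = u q" and "t = u (reflect_at \<nu> \<tau> q)"
      have st: "s \<le> t" using ball_nonneg[OF qc] by (simp add: gap_def s_def t_def)
      have s: "u p \<le> s" using p(2)[OF qc] by (simp add: s_def)
      have "f s \<le> f t" using mono st s up by (auto intro: mono_onD)
      moreover have "1 / (s powr \<gamma>) - 1 / (t powr \<gamma>) \<le> C * (t - s)"
        unfolding C_def by (rule inverse_powr_increment_bound[OF \<gamma>_pos up s st])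
      ultimately have "1 / (s powr \<gamma>) + f s - (1 / (t powr \<gamma>) + f t) \<le> C * gap \<tau> q"
        by (simp add: gap_def s_def[symmetric] t_def[symmetric])
      then show ?thesis
        using has_laplacian_gap[OF qD \<tau>] unfolding s_def t_def by blast
    qed
    show "z \<in> ball y (2 * r)" using dist_yz r by simp
  qed
  then show False using zK(3) by simp
qed

lemma gap_nonneg_left_limit:
  assumes "x \<in> closure \<Omega>" "x \<bullet> \<nu> < \<tau>" "\<tau> \<le> a"
    and before: "\<And>\<sigma>. x \<bullet> \<nu> \<le> \<sigma> \<Longrightarrow> \<sigma> < \<tau> \<Longrightarrow> gap \<sigma> x \<ge> 0"
  shows "gap \<tau> x \<ge> 0"
proof (rule ccontr)
  assume neg: "\<not> gap \<tau> x \<ge> 0"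
  have "continuous_on {x \<bullet> \<nu>..\<tau>} (\<lambda>\<sigma>. u (reflect_at \<nu> \<sigma> x))"
    by (rule continuous_on_compose2[OF continuous_u])
       (use reflect_in_closure assms in \<open>auto simp: reflect_at_def intro!: continuous_intros\<close>)
  then have cont: "continuous_on {x \<bullet> \<nu>..\<tau>} (\<lambda>\<sigma>. gap \<sigma> x)"
    unfolding gap_def by (intro continuous_intros)
  have "\<tau> \<in> {x \<bullet> \<nu>..\<tau>}" "0 < - gap \<tau> x" using assms(2) neg by auto
  with cont obtain d where d: "d > 0"
    "\<And>\<sigma>. \<sigma> \<in> {x \<bullet> \<nu>..\<tau>} \<Longrightarrow> dist \<sigma> \<tau> < d \<Longrightarrow> dist (gap \<sigma> x) (gap \<tau> x) < - gap \<tau> x"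
    unfolding continuous_on_iff by blast
  define \<sigma> where "\<sigma> = max (x \<bullet> \<nu>) (\<tau> - d / 2)"
  have \<sigma>: "x \<bullet> \<nu> \<le> \<sigma>" "\<sigma> < \<tau>" "dist \<sigma> \<tau> < d"
    using d(1) assms(2) by (auto simp: \<sigma>_def max_def dist_real_def)
  then show False using d(2)[of \<sigma>] before[of \<sigma>] neg by (auto simp: dist_real_def)
qed

text \<open>The continuation argument. There is nothing to prove for \<open>\<tau>\<close> below the whole domain, and the
  infimum \<open>\<tau>0\<close> of the bad positions is ruled out by \<open>gap_strictly_pos\<close> and
  \<open>gap_nonneg_extend\<close>.\<close>

theorem gap_nonneg:
  assumes "\<tau> < a" "x \<in> closure \<Omega>" "x \<bullet> \<nu> \<le> \<tau>"
  shows "gap \<tau> x \<ge> 0"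
proof -
  define P where "P \<tau> \<longleftrightarrow> (\<forall>x\<in>closure \<Omega>. x \<bullet> \<nu> \<le> \<tau> \<longrightarrow> gap \<tau> x \<ge> 0)" for \<tau>
  define S where "S = {\<tau>. \<tau> < a \<and> \<not> P \<tau>}"
  have "S = {}"
  proof (rule ccontr)
    assume "S \<noteq> {}"
    obtain B where B: "\<forall>x\<in>closure \<Omega>. norm x \<le> B"
      using bounded_closure[OF bounded_dom] unfolding bounded_iff by blast
    have "- B \<le> s" if s: "s \<in> S" for s
    proof -
      have "\<not> P s" using s by (simp add: S_def)
      then obtain x where x: "x \<in> closure \<Omega>" "x \<bullet> \<nu> \<le> s" unfolding P_def by blast
      then have "norm x \<le> B" using B by blast
      moreover have "\<bar>x \<bullet> \<nu>\<bar> \<le> norm x" using Cauchy_Schwarz_ineq2[of x \<nu>] unit by simp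
      ultimately show ?thesis using x(2) by linarith
    qed
    then have bdd: "bdd_below S" by (rule bdd_belowI)
    define \<tau>0 where "\<tau>0 = Inf S"
    have lower: "\<tau>0 \<le> s" if "s \<in> S" for s
      unfolding \<tau>0_def using bdd that by (rule cInf_lower[rotated])
    obtain s where "s \<in> S" using \<open>S \<noteq> {}\<close> by blast
    moreover from this have "s < a" by (simp add: S_def)
    ultimately have "\<tau>0 < a" using lower[of s] by simp
    have before: "P \<tau>" if "\<tau> < \<tau>0" for \<tau>
    proof -
      have "\<tau> \<notin> S" using lower[of \<tau>] that by auto
      then show ?thesis using that \<open>\<tau>0 < a\<close> by (simp add: S_def)
    qed
    have P0: "\<forall>x\<in>closure \<Omega>. x \<bullet> \<nu> \<le> \<tau>0 \<longrightarrow> gap \<tau>0 x \<ge> 0"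
    proof (intro ballI impI)
      fix x assume x: "x \<in> closure \<Omega>" "x \<bullet> \<nu> \<le> \<tau>0"
      show "gap \<tau>0 x \<ge> 0"
      proof (cases "x \<bullet> \<nu> = \<tau>0")
        case True
        then show ?thesis by (simp add: gap_hyperplane)
      next
        case False
        then have "x \<bullet> \<nu> < \<tau>0" using x by simp
        then show ?thesis
        proof (rule gap_nonneg_left_limit[OF x(1)])
          fix \<sigma> assume "x \<bullet> \<nu> \<le> \<sigma>" "\<sigma> < \<tau>0"
          then show "gap \<sigma> x \<ge> 0" using before[of \<sigma>] x(1) by (simp add: P_def)
        qed (use \<open>\<tau>0 < a\<close> in simp)
      qed
    qed
    obtain \<delta> where \<delta>: "\<delta> > 0"
      "\<forall>\<mu> \<tau>. \<tau> < a \<and> \<mu> \<le> \<tau> \<and> \<tau> - \<mu> \<le> \<delta> \<and>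
        (\<forall>x\<in>closure \<Omega>. x \<bullet> \<nu> \<le> \<mu> \<longrightarrow> gap \<tau> x \<ge> 0) \<longrightarrow>
        (\<forall>x\<in>closure \<Omega>. x \<bullet> \<nu> \<le> \<tau> \<longrightarrow> gap \<tau> x \<ge> 0)"
      using gap_nonneg_extend by blast
    let ?K = "closure \<Omega> \<inter> {x. x \<bullet> \<nu> \<le> \<tau>0 - \<delta> / 2}"
    have gap_lower: "\<exists>m>0. \<forall>x\<in>?K. m \<le> gap \<tau>0 x"
    proof (cases "?K = {}")
      case True
      then show ?thesis by (intro exI[of _ 1]) auto
    next
      case False
      have "continuous_on ?K (gap \<tau>0)"
        by (rule continuous_on_subset[OF continuous_gap]) (use \<open>\<tau>0 < a\<close> \<delta>(1) in auto)
      then obtain z where z: "z \<in> ?K" "\<And>x. x \<in> ?K \<Longrightarrow> gap \<tau>0 z \<le> gap \<tau>0 x"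
        using continuous_attains_inf[OF compact_slab(1) False] by blast
      have "gap \<tau>0 z > 0"
        using z(1) \<delta>(1) by (intro gap_strictly_pos[OF \<open>\<tau>0 < a\<close> P0]) auto
      then show ?thesis using z(2) by blast
    qed
    then obtain m where m: "m > 0" "\<forall>x\<in>?K. m \<le> gap \<tau>0 x" by blast
    obtain d where d: "d > 0"
      "\<forall>x\<in>closure \<Omega>. \<forall>y\<in>closure \<Omega>. dist y x < d \<longrightarrow> dist (u y) (u x) < m"
      using compact_uniformly_continuous[OF continuous_u compact_closure_dom] m(1)
      unfolding uniformly_continuous_on_def by blast
    define \<eta> where "\<eta> = min (\<delta> / 2) (min (d / 3) ((a - \<tau>0) / 2))"
    have \<eta>: "\<eta> > 0" "\<eta> \<le> \<delta> / 2" "\<eta> \<le> d / 3" "\<eta> \<le> (a - \<tau>0) / 2"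
      using \<delta>(1) d(1) \<open>\<tau>0 < a\<close>
      by (auto simp only: \<eta>_def min_less_iff_conj min.coboundedI1 min.coboundedI2
          half_gt_zero_iff diff_gt_0_iff_gt zero_less_divide_iff)
    \<comment> \<open>the lower bound \<open>m\<close> on \<open>?K\<close> survives a small move of the plane; the slab above \<open>?K\<close> is narrow\<close>
    have after: "P \<tau>" if \<tau>: "\<tau>0 \<le> \<tau>" "\<tau> \<le> \<tau>0 + \<eta>" for \<tau>
    proof -
      have "\<tau> < a" using \<tau> \<eta>(4) \<open>\<tau>0 < a\<close> by argo
      moreover have "\<tau>0 - \<delta> / 2 \<le> \<tau>" "\<tau> - (\<tau>0 - \<delta> / 2) \<le> \<delta>" using \<tau> \<eta> \<delta>(1) by auto
      moreover have "\<forall>x\<in>closure \<Omega>. x \<bullet> \<nu> \<le> \<tau>0 - \<delta> / 2 \<longrightarrow> gap \<tau> x \<ge> 0"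
      proof (intro ballI impI)
        fix x assume x: "x \<in> closure \<Omega>" "x \<bullet> \<nu> \<le> \<tau>0 - \<delta> / 2"
        have "dist (u (reflect_at \<nu> \<tau> x)) (u (reflect_at \<nu> \<tau>0 x)) < m"
        proof (rule d(2)[rule_format])
          show "reflect_at \<nu> \<tau>0 x \<in> closure \<Omega>" "reflect_at \<nu> \<tau> x \<in> closure \<Omega>"
            using x \<tau> \<delta>(1) \<open>\<tau>0 < a\<close> \<open>\<tau> < a\<close> by (auto intro!: reflect_in_closure)
          show "dist (reflect_at \<nu> \<tau> x) (reflect_at \<nu> \<tau>0 x) < d"
            unfolding dist_reflect_at[OF unit] using \<tau> \<eta> d(1) by auto
        qed
        moreover have "m \<le> gap \<tau>0 x" using m(2) x by auto
        ultimately show "gap \<tau> x \<ge> 0" unfolding gap_def dist_real_def by argo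
      qed
      ultimately show ?thesis using \<delta>(2) unfolding P_def by blast
    qed
    have "\<tau>0 + \<eta> \<le> Inf S"
    proof (rule cInf_greatest[OF \<open>S \<noteq> {}\<close>])
      fix s assume s: "s \<in> S"
      then have "\<not> P s" by (simp add: S_def)
      then show "\<tau>0 + \<eta> \<le> s" using after[of s] lower[OF s] by force
    qed
    then show False using \<eta>(1) unfolding \<tau>0_def by simp
  qed
  then show ?thesis using assms by (auto simp: S_def P_def)
qed

theorem u_le_u_reflect_at:
  assumes "x \<in> closure \<Omega>" "x \<bullet> \<nu> \<le> \<tau>" "\<tau> \<le> a"
  shows "u x \<le> u (reflect_at \<nu> \<tau> x)"
proof (cases "x \<bullet> \<nu> = \<tau>")
  case True
  then show ?thesis by (simp add: reflect_at_hyperplane)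
next
  case False
  then have "x \<bullet> \<nu> < \<tau>" using assms(2) by simp
  then have "gap \<tau> x \<ge> 0"
  proof (rule gap_nonneg_left_limit[OF assms(1) _ assms(3)])
    fix \<sigma> assume "x \<bullet> \<nu> \<le> \<sigma>" "\<sigma> < \<tau>"
    then show "gap \<sigma> x \<ge> 0" using assms by (intro gap_nonneg) auto
  qed
  then show ?thesis by (simp add: gap_def)
qed

end

section \<open>Admissible directions and the radial profile\<close>

text \<open>\<open>R\<^sub>\<tau> x\<close> lies strictly between \<open>x\<close> and its mirror image \<open>reflect \<nu> x\<close>.\<close>

lemma reflect_at_in_strictly_convex_dir:
  assumes conv: "strictly_convex_dir \<nu> \<Omega>" and sym: "reflect \<nu> ` \<Omega> = \<Omega>"
    and x: "x \<in> closure \<Omega>" "x \<bullet> \<nu> < \<tau>" "\<tau> < 0"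
  shows "reflect_at \<nu> \<tau> x \<in> \<Omega>"
proof -
  define y where "y = reflect \<nu> x"
  have "reflect \<nu> ` closure \<Omega> \<subseteq> closure (reflect \<nu> ` \<Omega>)"
    unfolding reflect_def
    by (intro image_closure_subset closure_subset closed_closure continuous_intros)
  then have y: "y \<in> closure \<Omega>" using x(1) sym by (auto simp: y_def)
  have diff: "y - x = (- 2 * (x \<bullet> \<nu>)) *\<^sub>R \<nu>" by (simp add: y_def reflect_def)
  have "\<nu> \<noteq> 0" using x by auto
  then have "x \<noteq> y" using diff x by auto
  define s where "s = (\<tau> - x \<bullet> \<nu>) / (- (x \<bullet> \<nu>))"
  have s: "0 < s" "s < 1" using x by (simp_all add: s_def divide_less_eq field_simps)
  have "s * (- 2 * (x \<bullet> \<nu>)) = 2 * (\<tau> - x \<bullet> \<nu>)" using x by (simp add: s_def field_simps)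
  then have "reflect_at \<nu> \<tau> x = x + s *\<^sub>R (y - x)"
    unfolding diff by (simp only: reflect_at_def scaleR_scaleR)
  also have "\<dots> = (1 - s) *\<^sub>R x + s *\<^sub>R y" by (simp add: algebra_simps)
  finally have "reflect_at \<nu> \<tau> x \<in> open_segment x y"
    using s \<open>x \<noteq> y\<close> by (auto simp: in_segment)
  moreover have "\<exists>t. y - x = t *\<^sub>R \<nu>" using diff by blast
  ultimately show ?thesis
    using conv x(1) y \<open>x \<noteq> y\<close> unfolding strictly_convex_dir_def by blast
qed

lemma reflect_uminus: "reflect (- \<nu>) = reflect \<nu>"
  by (rule ext) (simp add: reflect_def)

lemma strictly_convex_dir_uminus: "strictly_convex_dir (- \<nu>) \<Omega> \<longleftrightarrow> strictly_convex_dir \<nu> \<Omega>"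
proof -
  have "(\<exists>t. q - p = t *\<^sub>R - \<nu>) \<longleftrightarrow> (\<exists>t. q - p = t *\<^sub>R \<nu>)" for p q :: 'a
    by (metis scaleR_minus_left scaleR_minus_right minus_minus)
  then show ?thesis unfolding strictly_convex_dir_def by simp
qed

lemma reflect_at_in_ball:
  fixes \<nu> c x :: "'a::euclidean_space"
  assumes "norm \<nu> = 1" "x \<in> cball c R" "x \<bullet> \<nu> < \<tau>" "\<tau> < c \<bullet> \<nu>"
  shows "reflect_at \<nu> \<tau> x \<in> ball c R"
proof -
  define s where "s = \<tau> - x \<bullet> \<nu>"
  define z where "z = x - c"
  have eq: "reflect_at \<nu> \<tau> x - c = z + (2 * s) *\<^sub>R \<nu>"
    by (simp add: reflect_at_def s_def z_def)
  have "(norm (reflect_at \<nu> \<tau> x - c))\<^sup>2 = (norm z)\<^sup>2 + 4 * s * (z \<bullet> \<nu>) + 4 * s\<^sup>2 * (\<nu> \<bullet> \<nu>)"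
    unfolding eq power2_norm_eq_inner
    by (simp add: inner_add_left inner_add_right inner_commute power2_eq_square algebra_simps)
  also have "\<dots> = (norm z)\<^sup>2 + 4 * s * (z \<bullet> \<nu> + s)"
    using assms(1) by (simp add: norm_eq_1 power2_eq_square algebra_simps)
  also have "z \<bullet> \<nu> + s = \<tau> - c \<bullet> \<nu>" by (simp add: z_def s_def inner_diff_left)
  also have "(norm z)\<^sup>2 + 4 * s * (\<tau> - c \<bullet> \<nu>) < (norm z)\<^sup>2"
    using assms by (simp add: s_def mult_pos_neg)
  also have "\<dots> \<le> R\<^sup>2"
    using assms(2) by (intro power_mono) (auto simp: z_def dist_norm norm_minus_commute)
  finally have "norm (reflect_at \<nu> \<tau> x - c) < R"
    by (rule power_less_imp_less_base) (use assms(2) in \<open>auto intro: order_trans[OF zero_le_dist]\<close>)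
  then show ?thesis by (simp add: dist_norm norm_minus_commute)
qed

text \<open>The profile is read off along a coordinate vector \<open>e\<close>, so that the Laplacian splits into one radial
  second derivative and tangential ones along the other coordinate vectors.\<close>

lemma radial_profile_derivative_neg:
  fixes u :: "'a::euclidean_space \<Rightarrow> real"
  assumes C2: "Ck_on 2 (ball c R) u"
    and radial: "\<And>x y. x \<in> ball c R \<Longrightarrow> y \<in> ball c R \<Longrightarrow> dist c x = dist c y \<Longrightarrow> u x = u y"
    and e: "e \<in> Basis"
    and mono: "\<And>s t. 0 < s \<Longrightarrow> s \<le> t \<Longrightarrow> t < R \<Longrightarrow> u (c + t *\<^sub>R e) \<le> u (c + s *\<^sub>R e)"
    and superharmonic: "\<And>x. x \<in> ball c R \<Longrightarrow> laplacian u x < 0"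
    and r: "0 < r" "r < R"
  shows "\<exists>D<0. ((\<lambda>r. u (c + r *\<^sub>R e)) has_real_derivative D) (at r)"
proof -
  define U where "U = (\<lambda>r. u (c + r *\<^sub>R e))"
  define U' where "U' = (\<lambda>r. frechet_derivative u (at (c + r *\<^sub>R e)) e)"
  have norm_e: "norm e = 1" using e by simp
  have in_ball: "c + s *\<^sub>R e \<in> ball c R" if "\<bar>s\<bar> < R" for s
    using that norm_e by (simp add: dist_norm)
  have deriv: "(U has_real_derivative U' s) (at s)" if "0 < s" "s < R" for s
    unfolding U_def U'_def
    by (rule has_real_derivative_along_line, rule C2_derivs(1)[OF C2 in_ball]) (use that in auto)
  have nonpos: "U' s \<le> 0" if s: "0 < s" "s < R" for s
  proof (rule ccontr)
    assume "\<not> U' s \<le> 0"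
    then obtain d where d: "d > 0" "\<And>h. 0 < h \<Longrightarrow> h < d \<Longrightarrow> U s < U (s + h)"
      using DERIV_pos_inc_right[OF deriv[OF s]] by (auto simp: not_le)
    define h where "h = min d (R - s) / 2"
    have h: "0 < h" "h < d" "s + h < R" using d(1) s by (auto simp: h_def min_def field_simps)
    have "U (s + h) \<le> U s" using mono[of s "s + h"] s h by (simp add: U_def)
    then show False using d(2)[OF h(1,2)] by simp
  qed
  define p where "p = c + r *\<^sub>R e"
  have p: "p \<in> ball c R" using in_ball[of r] r by (simp add: p_def)
  have deriv2: "(U' has_real_derivative directional_deriv2 u p e e) (at r)"
    unfolding U'_def
    by (rule has_real_derivative_along_line) (use C2_derivs(2)[OF C2 p] in \<open>simp add: p_def\<close>)
  have "U' r \<noteq> 0"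
  proof
    assume crit: "U' r = 0"
    have "directional_deriv2 u p b b = 0" if b: "b \<in> Basis" for b
    proof (cases "b = e")
      case True
      have "directional_deriv2 u p e e = 0"
      proof (rule DERIV_local_max[OF deriv2])
        show "0 < min r (R - r)" using r by simp
        show "\<forall>s. \<bar>r - s\<bar> < min r (R - r) \<longrightarrow> U' s \<le> U' r"
          using nonpos crit by (auto simp: abs_less_iff)
      qed
      then show ?thesis using True by simp
    next
      case False
      \<comment> \<open>along the tangential line through \<open>p\<close> the solution is \<open>U (\<rho> t)\<close>\<close>
      define \<rho> where "\<rho> = (\<lambda>t. sqrt (r\<^sup>2 + t\<^sup>2))"
      have be: "b \<bullet> e = 0" using b e False by (simp add: inner_Basis)
      have norm_line: "norm (r *\<^sub>R e + t *\<^sub>R b) = \<rho> t" for t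
      proof -
        have "(norm (r *\<^sub>R e + t *\<^sub>R b))\<^sup>2 = r\<^sup>2 + t\<^sup>2"
          unfolding power2_norm_eq_inner using b e be
          by (simp add: inner_add_left inner_add_right inner_commute power2_eq_square)
        then show ?thesis unfolding \<rho>_def by (metis norm_ge_zero real_sqrt_unique)
      qed
      have \<rho>_pos: "\<rho> t > 0" for t using r by (simp add: \<rho>_def add_pos_nonneg)
      have \<rho>_deriv: "(\<rho> has_real_derivative t / \<rho> t) (at t)" for t
        unfolding \<rho>_def using r
        by (auto intro!: derivative_eq_intros simp: add_pos_nonneg not_sum_power2_lt_zero field_simps)
      have "\<rho> 0 = r" using r by (simp add: \<rho>_def)
      have line: "\<forall>\<^sub>F t in nhds 0. p + t *\<^sub>R b \<in> ball c R"
        by (rule eventually_in_open_line[OF open_ball p])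
      have dist_line: "dist c (p + t *\<^sub>R b) = \<rho> t" for t
      proof -
        have "p + t *\<^sub>R b - c = r *\<^sub>R e + t *\<^sub>R b" by (simp add: p_def)
        then show ?thesis using norm_line[of t] by (metis dist_commute dist_norm)
      qed
      have "\<forall>\<^sub>F t in nhds 0. (U (\<rho> t)) = u (p + t *\<^sub>R b) "
        using line
      proof eventually_elim
        case (elim t)
        then have "\<rho> t < R" using dist_line[of t] by simp
        then show ?case unfolding U_def using elim dist_line[of t] \<rho>_pos[of t] norm_e
          by (intro radial in_ball) (auto simp: dist_norm)
      qed
      moreover have "has_deriv2 (\<lambda>t. U (\<rho> t)) (U' r / r)"
        unfolding has_deriv2_def
      proof (intro exI conjI)
        show "\<forall>\<^sub>F t in nhds 0. ((\<lambda>t. U (\<rho> t)) has_real_derivative U' (\<rho> t) / \<rho> t * t) (at t)"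
          using line
        proof eventually_elim
          case (elim t)
          then have "\<rho> t < R" using dist_line[of t] by simp
          from DERIV_chain2[OF deriv[OF \<rho>_pos this] \<rho>_deriv] show ?case by simp
        qed
        have "(U' has_real_derivative directional_deriv2 u p e e) (at (\<rho> 0))"
          using deriv2 \<open>\<rho> 0 = r\<close> by simp
        from DERIV_chain2[OF this \<rho>_deriv]
        have "((\<lambda>t. U' (\<rho> t)) has_real_derivative 0) (at 0)" by simp
        moreover have "\<rho> 0 \<noteq> 0" using \<rho>_pos[of 0] by simp
        ultimately have "((\<lambda>t. U' (\<rho> t) / \<rho> t * t) has_real_derivative
            (0 * \<rho> 0 - U' (\<rho> 0) * (0 / \<rho> 0)) / (\<rho> 0 * \<rho> 0) * 0 + 1 * (U' (\<rho> 0) / \<rho> 0)) (at 0)"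
          by (intro DERIV_mult DERIV_divide \<rho>_deriv DERIV_ident)
        then show "((\<lambda>t. U' (\<rho> t) / \<rho> t * t) has_real_derivative U' r / r) (at 0)"
          unfolding \<open>\<rho> 0 = r\<close> by simp
      qed
      ultimately have "has_deriv2 (\<lambda>t. u (p + t *\<^sub>R b)) (U' r / r)"
        by (rule has_deriv2_cong[rotated])
      from has_deriv2_unique[OF has_deriv2_along_line[OF open_ball C2 p] this] crit
      show ?thesis by simp
    qed
    then have "laplacian u p = 0" by (simp add: laplacian_eq)
    then show False using superharmonic[OF p] by simp
  qed
  then have "U' r < 0" using nonpos[OF r] by simp
  then show ?thesis using deriv[OF r] unfolding U_def by blast
qed

section \<open>Symmetry and monotonicity of the solution\<close>

theorem theorem1p1:
  fixes \<gamma> :: real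
    and \<Omega> :: "(real ^ 'n) set"
    and f :: "real \<Rightarrow> real"
    and u :: "real ^ 'n \<Rightarrow> real"
    and \<nu> :: "real ^ 'n"
  assumes "\<gamma> > 0"
    and "bounded_smooth_domain \<Omega>"
    and "locally_lipschitz_on {0..} f"
    and "mono_on {0..} f"
    and "\<And>s. s > 0 \<Longrightarrow> f s > 0"
    and "f 0 \<ge> 0"
    and "singular_solution \<gamma> f \<Omega> u"
    and "norm \<nu> = 1"
    and "strictly_convex_dir \<nu> \<Omega>"
    and "reflect \<nu> ` \<Omega> = \<Omega>"
  shows "(\<forall>x\<in>\<Omega>. u x = u (reflect \<nu> x)) \<and>
    nondecreasing_dir \<nu> {x \<in> \<Omega>. x \<bullet> \<nu> < 0} u \<and>
    (\<forall>c R. R > 0 \<and> \<Omega> = ball c R \<longrightarrow>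
      (\<exists>U. (\<forall>x\<in>\<Omega>. u x = U (dist c x)) \<and>
        (\<forall>r. 0 < r \<and> r < R \<longrightarrow> (\<exists>D<0. (U has_real_derivative D) (at r)))))"
proof (intro conjI allI impI)
  have domain: "open \<Omega>" "bounded \<Omega>" using assms(2) by (auto simp: bounded_smooth_domain_def)
  have planes: "moving_planes \<gamma> f \<Omega> u \<mu> 0" if "\<mu> = \<nu> \<or> \<mu> = - \<nu>" for \<mu>
  proof
    show "reflect_at \<mu> \<tau> x \<in> \<Omega>" if "x \<in> closure \<Omega>" "x \<bullet> \<mu> < \<tau>" "\<tau> < 0" for x \<tau>
      using reflect_at_in_strictly_convex_dir[OF _ _ that] assms(9,10) \<open>\<mu> = \<nu> \<or> \<mu> = - \<nu>\<close>
      by (auto simp: reflect_uminus strictly_convex_dir_uminus)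
  qed (use assms domain that in auto)
  have le_reflect: "u x \<le> u (reflect \<nu> x)" if "x \<in> closure \<Omega>" for x
  proof (cases "x \<bullet> \<nu> \<le> 0")
    case True
    then show ?thesis
      using moving_planes.u_le_u_reflect_at[OF planes[of \<nu>], of x 0] that
      by (simp add: reflect_at_def reflect_def)
  next
    case False
    then show ?thesis
      using moving_planes.u_le_u_reflect_at[OF planes[of "- \<nu>"], of x 0] that
      by (simp add: reflect_at_def reflect_def)
  qed
  show "\<forall>x\<in>\<Omega>. u x = u (reflect \<nu> x)"
  proof
    fix x assume x: "x \<in> \<Omega>"
    then have "reflect \<nu> x \<in> \<Omega>" using assms(10) by blast
    with x have "x \<in> closure \<Omega>" "reflect \<nu> x \<in> closure \<Omega>" using closure_subset by blast+
    moreover have "reflect \<nu> (reflect \<nu> x) = x"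
      using assms(8) by (simp add: reflect_def inner_diff_left norm_eq_1)
    ultimately show "u x = u (reflect \<nu> x)"
      using le_reflect[of x] le_reflect[of "reflect \<nu> x"] by simp
  qed
  show "nondecreasing_dir \<nu> {x \<in> \<Omega>. x \<bullet> \<nu> < 0} u"
    unfolding nondecreasing_dir_def
  proof (intro ballI allI impI)
    fix x and t :: real
    assume x: "x \<in> {x \<in> \<Omega>. x \<bullet> \<nu> < 0}" "0 \<le> t" "x + t *\<^sub>R \<nu> \<in> {x \<in> \<Omega>. x \<bullet> \<nu> < 0}"
    then have "x \<bullet> \<nu> + t < 0" using assms(8) by (simp add: inner_add_left norm_eq_1)
    then have "u x \<le> u (reflect_at \<nu> (x \<bullet> \<nu> + t / 2) x)"
      using x closure_subset[of \<Omega>]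
      by (intro moving_planes.u_le_u_reflect_at[OF planes[of \<nu>]]) auto
    then show "u x \<le> u (x + t *\<^sub>R \<nu>)" by (simp add: reflect_at_def)
  qed
  fix c R assume ball: "R > 0 \<and> \<Omega> = ball c R"
  have ball_planes: "moving_planes \<gamma> f \<Omega> u \<mu> (c \<bullet> \<mu>)" if "norm \<mu> = 1" for \<mu>
  proof
    show "reflect_at \<mu> \<tau> x \<in> \<Omega>" if "x \<in> closure \<Omega>" "x \<bullet> \<mu> < \<tau>" "\<tau> < c \<bullet> \<mu>" for x \<tau>
      using reflect_at_in_ball[OF \<open>norm \<mu> = 1\<close>, of x c R \<tau>] that ball by auto
  qed (use assms domain that in auto)
  \<comment> \<open>the perpendicular bisector of \<open>x\<close> and \<open>y\<close> passes through \<open>c\<close>\<close>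
  have le_radial: "u x \<le> u y" if xy: "x \<in> \<Omega>" "dist c x = dist c y" "x \<noteq> y" for x y
  proof -
    define \<mu> where "\<mu> = (1 / norm (y - x)) *\<^sub>R (y - x)"
    have \<mu>: "norm \<mu> = 1" "y - x = norm (y - x) *\<^sub>R \<mu>" using xy(3) by (auto simp: \<mu>_def)
    have "(c - x) \<bullet> (c - x) = (c - y) \<bullet> (c - y)"
      using xy(2) by (simp add: dist_norm norm_eq)
    then have half: "2 * ((c - x) \<bullet> (y - x)) = (y - x) \<bullet> (y - x)"
      by (simp add: inner_diff_left inner_diff_right inner_commute)
    have "2 * ((c - x) \<bullet> \<mu>) = (2 * ((c - x) \<bullet> (y - x))) / norm (y - x)"
      by (simp add: \<mu>_def)
    also have "\<dots> = norm (y - x)"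
      unfolding half using xy(3) by (simp add: power2_norm_eq_inner[symmetric] power2_eq_square)
    finally have d: "2 * (c \<bullet> \<mu> - x \<bullet> \<mu>) = norm (y - x)" by (simp add: inner_diff_left)
    have "0 \<le> 2 * (c \<bullet> \<mu> - x \<bullet> \<mu>)" unfolding d by (rule norm_ge_zero)
    then have "x \<bullet> \<mu> \<le> c \<bullet> \<mu>" by simp
    then have "u x \<le> u (reflect_at \<mu> (c \<bullet> \<mu>) x)"
      using xy(1) closure_subset[of \<Omega>]
      by (intro moving_planes.u_le_u_reflect_at[OF ball_planes[OF \<mu>(1)]]) auto
    also have "reflect_at \<mu> (c \<bullet> \<mu>) x = y"
      unfolding reflect_at_def d using \<mu>(2) by (metis add.commute diff_add_cancel)
    finally show ?thesis .
  qed
  have radial: "u x = u y" if "x \<in> \<Omega>" "y \<in> \<Omega>" "dist c x = dist c y" for x y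
    using le_radial[of x y] le_radial[of y x] that by fastforce
  define e :: "real ^ 'n" where "e = axis undefined 1"
  have e: "e \<in> Basis" by (simp add: e_def axis_in_Basis_iff)
  then have norm_e: "norm e = 1" by simp
  have C2: "Ck_on 2 (ball c R) u" using assms(7) ball by (simp add: singular_solution_def)
  have decreasing: "u (c + t *\<^sub>R e) \<le> u (c + s *\<^sub>R e)" if "0 < s" "s \<le> t" "t < R" for s t
  proof -
    \<comment> \<open>planes moving inwards along \<open>- e\<close>, stopped midway between the two points\<close>
    have "u (c + t *\<^sub>R e) \<le> u (reflect_at (- e) ((c + t *\<^sub>R e) \<bullet> (- e) + (t - s) / 2) (c + t *\<^sub>R e))"
    proof (rule moving_planes.u_le_u_reflect_at[OF ball_planes])
      have "c + t *\<^sub>R e \<in> \<Omega>" using that ball norm_e by (simp add: dist_norm)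
      then show "c + t *\<^sub>R e \<in> closure \<Omega>" using closure_subset by blast
      show "(c + t *\<^sub>R e) \<bullet> (- e) + (t - s) / 2 \<le> c \<bullet> (- e)"
        using that norm_e by (simp add: inner_add_left norm_eq_1)
    qed (use that norm_e in auto)
    also have "reflect_at (- e) ((c + t *\<^sub>R e) \<bullet> (- e) + (t - s) / 2) (c + t *\<^sub>R e)
        = (c + t *\<^sub>R e) + (t - s) *\<^sub>R (- e)"
    proof -
      have "2 * (q + (t - s) / 2 - q) = t - s" for q :: real by (simp add: field_simps)
      then show ?thesis by (simp only: reflect_at_def)
    qed
    also have "\<dots> = c + s *\<^sub>R e" by (simp add: scaleR_diff_left)
    finally show ?thesis .
  qed
  have superharmonic: "laplacian u x < 0" if "x \<in> ball c R" for x
  proof -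
    have "u x > 0" "- laplacian u x = 1 / (u x powr \<gamma>) + f (u x)"
      using assms(7) that ball by (auto simp: singular_solution_def)
    moreover from this have "1 / (u x powr \<gamma>) > 0" "f (u x) > 0" using assms(5) by auto
    ultimately show ?thesis by linarith
  qed
  show "\<exists>U. (\<forall>x\<in>\<Omega>. u x = U (dist c x)) \<and>
      (\<forall>r. 0 < r \<and> r < R \<longrightarrow> (\<exists>D<0. (U has_real_derivative D) (at r)))"
  proof (intro exI[of _ "\<lambda>r. u (c + r *\<^sub>R e)"] conjI ballI allI impI)
    fix x assume x: "x \<in> \<Omega>"
    have "dist c (c + dist c x *\<^sub>R e) = dist c x" using norm_e by (simp add: dist_norm)
    then show "u x = u (c + dist c x *\<^sub>R e)" using x ball by (intro radial) auto
  next
    fix r assume r: "0 < r \<and> r < R"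
    show "\<exists>D<0. ((\<lambda>r. u (c + r *\<^sub>R e)) has_real_derivative D) (at r)"
    proof (rule radial_profile_derivative_neg[OF C2 _ e decreasing superharmonic])
      show "u x = u y" if "x \<in> ball c R" "y \<in> ball c R" "dist c x = dist c y" for x y
        using radial[of x y] that ball by blast
    qed (use r in auto)
  qed
qed

end
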